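(* Let $A \in \mathbb{R}^{m\times m}$ be symmetric positive definite, let $y \in \mathbb{R}^m$ be nonzero, let $\Omega \in \mathbb{R}^{m\times n_\Omega}$, and let $k \ge 1$ be an integer. Let $\widehat{W}_k$ be the orthonormal basis of the augmented Krylov subspace $\mathcal{K}_k(A,[y,\Omega])$ computed by the block Lanczos method (in particular, its first column is $y/\lVert y\rVert_2$) and let $\widehat{T}_k = \widehat{W}_k^{\top}A\widehat{W}_k$. Let $s$ be an integer with $0 \le s \le k$, and let $P = (I+X)^{-1}$ be any symmetric positive definite matrix, where $X\in\mathbb{R}^{m\times m}$ satisfies $\operatorname{range}(X) \subseteq \mathcal{K}_{s+1}(A,\Omega)$. Then $$0 \le \frac{y^{\top}A^{-1}y - \lVert y\rVert_2^2\,(\widehat{T}_k^{-1})_{11}}{y^{\top}A^{-1}y} \le 4\left(\frac{\sqrt{\widetilde{\kappa}}-1}{\sqrt{\widetilde{\kappa}}+1}\right)^{2(k-s)},$$ where $\widetilde{\kappa}$ is the condition number of the preconditioned matrix $P^{-1/2}AP^{-1/2}$.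
   Context: For a matrix or vector $Z$ with $m$ rows and an integer $j\ge 1$, $\mathcal{K}_j(A,Z)$ denotes the (block) Krylov subspace, i.e. the span of all columns of $Z, AZ, \dots, A^{j-1}Z$. The block Lanczos method successively orthonormalizes the blocks $Z, AZ, \dots, A^{k-1}Z$ with $Z=[y,\Omega]$, starting with a QR factorization of $Z$; the resulting matrix $\widehat{W}_k$ has orthonormal columns forming a basis of $\mathcal{K}_k(A,[y,\Omega])$, with first column $y/\lVert y\rVert_2$. Standing assumption: the block size remains constant, i.e. the columns of $[y,\Omega], A[y,\Omega], \dots, A^{k-1}[y,\Omega]$ are linearly independent. $(M)_{11}$ denotes the top left entry of a matrix $M$. The condition number of a symmetric positive definite matrix is the ratio of its largest to its smallest eigenvalue. $I$ is the $m\times m$ identity matrix. *)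

theory Defs
  imports
    "Jordan_Normal_Form.Spectral_Radius"
    "Jordan_Normal_Form.Gauss_Jordan_Elimination"
    "Jordan_Normal_Form.VS_Connect"
begin

definition eucl_norm :: "real vec \<Rightarrow> real" where
  "eucl_norm v = sqrt (v \<bullet> v)"

text \<open>Only meaningful for invertible matrices; otherwise the value is unspecified.\<close>

definition mat_inv :: "real mat \<Rightarrow> real mat" where
  "mat_inv M = the (mat_inverse M)"

definition spd :: "nat \<Rightarrow> real mat \<Rightarrow> bool" where
  "spd n M \<longleftrightarrow> M \<in> carrier_mat n n \<and> M\<^sup>T = M \<and>
     (\<forall>v \<in> carrier_vec n. v \<noteq> 0\<^sub>v n \<longrightarrow> 0 < v \<bullet> (M *\<^sub>v v))"

text \<open>The principal square root: a symmetric positive definite matrix has exactly one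
  symmetric positive definite square root.\<close>

definition mat_sqrt :: "real mat \<Rightarrow> real mat" where
  "mat_sqrt M = (THE S. spd (dim_row M) S \<and> S * S = M)"

definition mat_inv_sqrt :: "real mat \<Rightarrow> real mat" where
  "mat_inv_sqrt M = mat_inv (mat_sqrt M)"

definition condition_number :: "real mat \<Rightarrow> real" where
  "condition_number M = Max (spectrum M) / Min (spectrum M)"

definition vec_span :: "nat \<Rightarrow> real vec set \<Rightarrow> real vec set" where
  "vec_span m S = LinearCombinations.module.span class_ring (module_vec TYPE(real) m) S"

text \<open>Linear independence of a family: a repeated vector makes the list dependent.\<close>

definition lin_indpt_list :: "nat \<Rightarrow> real vec list \<Rightarrow> bool" where
  "lin_indpt_list m vs \<longleftrightarrow> distinct vs \<and>
     \<not> LinearCombinations.module.lin_dep class_ring (module_vec TYPE(real) m) (set vs)"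

text \<open>The columns of \<open>Z, A Z, \<dots>, A\<^sup>j\<^sup>-\<^sup>1 Z\<close>, in this order.\<close>

definition krylov_cols :: "real mat \<Rightarrow> real mat \<Rightarrow> nat \<Rightarrow> real vec list" where
  "krylov_cols A Z j = concat (map (\<lambda>i. cols (A ^\<^sub>m i * Z)) [0..<j])"

definition krylov :: "real mat \<Rightarrow> real mat \<Rightarrow> nat \<Rightarrow> real vec set" where
  "krylov A Z j = vec_span (dim_row A) (set (krylov_cols A Z j))"

definition mat_range :: "real mat \<Rightarrow> real vec set" where
  "mat_range X = {X *\<^sub>v v | v. v \<in> carrier_vec (dim_col X)}"

text \<open>The augmented starting block \<open>[y, \<Omega>]\<close>.\<close>

definition augment :: "real vec \<Rightarrow> real mat \<Rightarrow> real mat" where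
  "augment y \<Omega> = mat_of_cols (dim_vec y) (y # cols \<Omega>)"

text \<open>Blocks of \<open>W\<close> with block size \<open>b\<close>, counted from \<open>0\<close>: the first \<open>j\<close> blocks together,
  and the block with index \<open>j\<close>.\<close>

definition leading_blocks :: "nat \<Rightarrow> real mat \<Rightarrow> nat \<Rightarrow> real mat" where
  "leading_blocks b W j = mat_of_cols (dim_row W) (take (j * b) (cols W))"

definition block_of :: "nat \<Rightarrow> real mat \<Rightarrow> nat \<Rightarrow> real mat" where
  "block_of b W j = mat_of_cols (dim_row W) (take b (drop (j * b) (cols W)))"

text \<open>\<open>W\<close> is a possible output of \<open>k\<close> steps of the block Lanczos method for \<open>A\<close> with starting
  block \<open>Z\<close>. The block \<open>Q\<close> of index \<open>j\<close> arises from \<open>A\<^sup>j Z\<close> by orthogonalizing against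
  the previous blocks \<open>V\<close> and orthonormalizing the remainder, as \<open>Q * R\<close>. For \<open>j = 0\<close> this is
  a QR factorization of \<open>Z\<close>. For \<open>j > 0\<close> the factor \<open>R\<close> is an arbitrary square matrix, so when
  the block size remains constant it does not matter whether \<open>A\<^sup>j Z\<close> or \<open>A\<close> times the previous
  block of \<open>W\<close> is orthogonalized: the remainders differ by an invertible factor on the right.
  No signs are fixed.\<close>

definition block_lanczos :: "real mat \<Rightarrow> real mat \<Rightarrow> nat \<Rightarrow> real mat \<Rightarrow> bool" where
  "block_lanczos A Z k W \<longleftrightarrow>
     (let b = dim_col Z in
        W \<in> carrier_mat (dim_row Z) (k * b) \<and>
        W\<^sup>T * W = 1\<^sub>m (k * b) \<and>
        (\<forall>j<k. let V = leading_blocks b W j; Q = block_of b W j; B = A ^\<^sub>m j * Z in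
           \<exists>R \<in> carrier_mat b b.
             (j = 0 \<longrightarrow> upper_triangular R) \<and> B - V * (V\<^sup>T * B) = Q * R))"

end

theory Submission
  imports Defs
begin

text \<open>
  Write \<open>x = A\<^sup>-\<^sup>1 y\<close> and \<open>|v|\<^sub>A\<^sup>2 = v \<bullet> A v\<close>, so that \<open>y \<bullet> A\<^sup>-\<^sup>1 y = |x|\<^sub>A\<^sup>2\<close>. Since the first column of \<open>W\<close> is
  the normalized \<open>y\<close>, the subtracted term is \<open>f \<bullet> T\<^sup>-\<^sup>1 f\<close> with \<open>f = W\<^sup>T A x\<close>. This is the squared energy
  norm of the \<open>A\<close>-orthogonal projection of \<open>x\<close> to the range of \<open>W\<close>. The numerator is therefore the
  smallest value of \<open>|x - z|\<^sub>A\<^sup>2\<close> over \<open>z\<close> in that range (\<open>galerkin_energy_error\<close>). It is nonnegative,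
  and every choice of \<open>z\<close> gives an upper bound.

  A good \<open>z\<close> is what the conjugate gradient method with preconditioner \<open>P\<^sup>-\<^sup>1 = I + X\<close> would produce.
  With \<open>N = (I + X) A\<close> and \<open>z = N q(N) x\<close>, the error is \<open>x - z = p(N) x\<close> with \<open>p(t) = 1 - t q(t)\<close>.
  Each multiplication by \<open>I + X\<close> only adds elements of \<open>K\<^sub>s\<^sub>+\<^sub>1(A, \<Omega>)\<close>, so for \<open>q\<close> of degree below \<open>k - s\<close>
  the vector \<open>z\<close> lies in \<open>K\<^sub>k\<^sub>-\<^sub>s(A, y) + K\<^sub>k(A, \<Omega>)\<close> (\<open>polynomial_iterate_in_joint_krylov\<close>), and hence in
  the range of \<open>W\<close> (\<open>block_lanczos_range\<close>).

  The matrix \<open>N\<close> is similar to \<open>P\<^sup>-\<^sup>1\<^sup>/\<^sup>2 A P\<^sup>-\<^sup>1\<^sup>/\<^sup>2\<close>, and it has an eigenbasis that is orthogonal for the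
  energy inner product (\<open>preconditioned_eigenbasis\<close>). Thus \<open>|p(N) x|\<^sub>A\<close> is at most \<open>|x|\<^sub>A\<close> times the
  maximum of \<open>|p|\<close> on the interval spanned by the spectrum. A shifted and rescaled Chebyshev polynomial
  makes this maximum at most \<open>2 ((\<surd>\<kappa> - 1) / (\<surd>\<kappa> + 1))\<^sup>k\<^sup>-\<^sup>s\<close> (\<open>chebyshev_residual_polynomial\<close>), and
  squaring gives the bound.
\<close>

section \<open>Real symmetric matrices\<close>

lemma symmetric_scalar_prod:
  fixes M :: "real mat"
  assumes M: "M \<in> carrier_mat n n" "M\<^sup>T = M" and u: "u \<in> carrier_vec n" and v: "v \<in> carrier_vec n"
  shows "u \<bullet> (M *\<^sub>v v) = (M *\<^sub>v u) \<bullet> v"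
  using transpose_vec_mult_scalar[OF M(1) v u] M(2) M u v
  by (metis comm_scalar_prod mult_mat_vec_carrier)

lemma scalar_prod_self_pos:
  fixes v :: "real vec"
  assumes "v \<in> carrier_vec n" "v \<noteq> 0\<^sub>v n"
  shows "0 < v \<bullet> v"
proof -
  have "\<exists>i<n. v $ i \<noteq> 0" using assms by (auto intro!: eq_vecI)
  then obtain i where i: "i < n" "v $ i \<noteq> 0" by blast
  have "0 < v $ i * v $ i" using i by (simp add: power2_eq_square[symmetric])
  also have "\<dots> \<le> (\<Sum>i<n. v $ i * v $ i)"
    by (rule member_le_sum) (use i in auto)
  finally show ?thesis using assms by (simp add: scalar_prod_def atLeast0LessThan)
qed

text \<open>Over the complex numbers an eigenvalue \<open>\<mu>\<close> exists. If its eigenvector is \<open>a + \<i> b\<close> with real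
  \<open>a\<close> and \<open>b\<close>, symmetry in the form \<open>b \<bullet> M a = M b \<bullet> a\<close> reads \<open>Im \<mu> (a \<bullet> a + b \<bullet> b) = 0\<close>. So \<open>\<mu>\<close> is
  real, and whichever of \<open>a\<close> and \<open>b\<close> is nonzero is a real eigenvector.\<close>

lemma symmetric_real_eigenvector:
  fixes M :: "real mat"
  assumes M: "M \<in> carrier_mat n n" and sym: "M\<^sup>T = M" and n: "0 < n"
  shows "\<exists>ev v. v \<in> carrier_vec n \<and> v \<bullet> v = 1 \<and> M *\<^sub>v v = ev \<cdot>\<^sub>v v"
proof -
  let ?C = "map_mat complex_of_real M"
  have C: "?C \<in> carrier_mat n n" using M by auto
  obtain \<mu> where "\<mu> \<in> spectrum ?C" using spectrum_non_empty[OF C n] by blast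
  then obtain w where w: "w \<in> carrier_vec n" "w \<noteq> 0\<^sub>v n" "?C *\<^sub>v w = \<mu> \<cdot>\<^sub>v w"
    using M by (auto simp: spectrum_def eigenvalue_def eigenvector_def)
  define a where "a = map_vec Re w"
  define b where "b = map_vec Im w"
  have [simp]: "a \<in> carrier_vec n" "b \<in> carrier_vec n" using w by (auto simp: a_def b_def)
  have [simp]: "dim_vec a = n" "dim_vec b = n" using w by (auto simp: a_def b_def)
  have comp: "(\<Sum>j = 0..<n. complex_of_real (M $$ (i,j)) * w $ j) = \<mu> * w $ i" if "i < n" for i
  proof -
    have "(\<Sum>j = 0..<n. complex_of_real (M $$ (i,j)) * w $ j) = (?C *\<^sub>v w) $ i"
      using M w(1) that by (auto simp: scalar_prod_def)
    also have "\<dots> = \<mu> * w $ i" using w that by simp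
    finally show ?thesis .
  qed
  have Ma: "M *\<^sub>v a = Re \<mu> \<cdot>\<^sub>v a - Im \<mu> \<cdot>\<^sub>v b"
  proof (rule eq_vecI)
    fix i assume "i < dim_vec (Re \<mu> \<cdot>\<^sub>v a - Im \<mu> \<cdot>\<^sub>v b)"
    then have i: "i < n" using w by (auto simp: a_def b_def)
    show "(M *\<^sub>v a) $ i = (Re \<mu> \<cdot>\<^sub>v a - Im \<mu> \<cdot>\<^sub>v b) $ i"
      using arg_cong[OF comp[OF i], of Re] i M w by (auto simp: scalar_prod_def a_def b_def)
  qed (use M w in \<open>auto simp: b_def\<close>)
  have Mb: "M *\<^sub>v b = Re \<mu> \<cdot>\<^sub>v b + Im \<mu> \<cdot>\<^sub>v a"
  proof (rule eq_vecI)
    fix i assume "i < dim_vec (Re \<mu> \<cdot>\<^sub>v b + Im \<mu> \<cdot>\<^sub>v a)"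
    then have i: "i < n" using w by (auto simp: a_def b_def)
    show "(M *\<^sub>v b) $ i = (Re \<mu> \<cdot>\<^sub>v b + Im \<mu> \<cdot>\<^sub>v a) $ i"
      using arg_cong[OF comp[OF i], of Im] i M w by (auto simp: scalar_prod_def a_def b_def algebra_simps)
  qed (use M w in \<open>auto simp: a_def\<close>)
  have ab: "a \<noteq> 0\<^sub>v n \<or> b \<noteq> 0\<^sub>v n"
  proof (rule ccontr)
    assume "\<not> ?thesis"
    then have z: "a = 0\<^sub>v n" "b = 0\<^sub>v n" by auto
    have "w = 0\<^sub>v n"
    proof (rule eq_vecI)
      fix i assume "i < dim_vec (0\<^sub>v n :: complex vec)"
      then have i: "i < n" by simp
      have "a $ i = 0" "b $ i = 0" using z i by auto
      then show "w $ i = 0\<^sub>v n $ i" using i w by (auto simp: a_def b_def complex_eq_iff)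
    qed (use w in auto)
    with w show False by simp
  qed
  have pos: "0 < a \<bullet> a + b \<bullet> b"
  proof -
    have "0 \<le> a \<bullet> a" "0 \<le> b \<bullet> b" by (auto simp: scalar_prod_def intro: sum_nonneg)
    moreover have "0 < a \<bullet> a \<or> 0 < b \<bullet> b"
      using ab scalar_prod_self_pos[of a n] scalar_prod_self_pos[of b n] by auto
    ultimately show ?thesis by linarith
  qed
  have "b \<bullet> (M *\<^sub>v a) = (M *\<^sub>v b) \<bullet> a" by (rule symmetric_scalar_prod[OF M sym]) auto
  then have "Im \<mu> * (a \<bullet> a + b \<bullet> b) = 0"
    unfolding Ma Mb
    by (simp add: scalar_prod_minus_distrib[of _ n] add_scalar_prod_distrib[of _ n]
        comm_scalar_prod[of b n a] algebra_simps)
  then have im: "Im \<mu> = 0" using pos by auto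
  have "\<exists>v. v \<in> carrier_vec n \<and> v \<noteq> 0\<^sub>v n \<and> M *\<^sub>v v = Re \<mu> \<cdot>\<^sub>v v"
  proof -
    have "M *\<^sub>v a = Re \<mu> \<cdot>\<^sub>v a" "M *\<^sub>v b = Re \<mu> \<cdot>\<^sub>v b"
      unfolding Ma Mb im by (auto intro!: eq_vecI simp: a_def b_def w(1)[THEN carrier_vecD])
    with ab show ?thesis by (metis \<open>a \<in> carrier_vec n\<close> \<open>b \<in> carrier_vec n\<close>)
  qed
  then obtain v where v: "v \<in> carrier_vec n" "v \<noteq> 0\<^sub>v n" "M *\<^sub>v v = Re \<mu> \<cdot>\<^sub>v v" by blast
  define c where "c = 1 / sqrt (v \<bullet> v)"
  have vv: "0 < v \<bullet> v" using scalar_prod_self_pos v by blast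
  have "(c \<cdot>\<^sub>v v) \<bullet> (c \<cdot>\<^sub>v v) = 1" using vv v by (simp add: c_def field_simps)
  moreover have "M *\<^sub>v (c \<cdot>\<^sub>v v) = Re \<mu> \<cdot>\<^sub>v (c \<cdot>\<^sub>v v)"
    using mult_mat_vec[OF M v(1), of c] v(3) by (simp add: smult_smult_assoc mult.commute)
  ultimately show ?thesis using v by (intro exI[of _ "Re \<mu>"] exI[of _ "c \<cdot>\<^sub>v v"]) auto
qed

text \<open>The reflection in the hyperplane orthogonal to \<open>w = v - e\<^sub>0\<close> exchanges \<open>e\<^sub>0\<close> and \<open>v\<close>, because both have
  length one. It serves to extend a single unit vector to an orthonormal basis.\<close>

lemma householder_reflection:
  fixes v :: "real vec"
  assumes v: "v \<in> carrier_vec n" "v \<bullet> v = 1" and n: "0 < n"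
  shows "\<exists>H \<in> carrier_mat n n. H\<^sup>T = H \<and> H * H = 1\<^sub>m n \<and> col H 0 = v"
proof (cases "v = unit_vec n 0")
  case True
  then show ?thesis using n by (intro bexI[of _ "1\<^sub>m n"]) auto
next
  case False
  define w where "w = v - unit_vec n 0"
  have w: "w \<in> carrier_vec n" using v by (auto simp: w_def)
  have w0: "w \<noteq> 0\<^sub>v n"
  proof
    assume "w = 0\<^sub>v n"
    then have "v $ i - unit_vec n 0 $ i = 0" if "i < n" for i
    proof -
      have "v $ i - unit_vec n 0 $ i = w $ i" using that v by (simp add: w_def)
      then show ?thesis using \<open>w = 0\<^sub>v n\<close> that by simp
    qed
    then have "v = unit_vec n 0" using v by (intro eq_vecI) auto
    with False show False by simp
  qed
  have ww: "0 < w \<bullet> w" by (rule scalar_prod_self_pos[OF w w0])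
  define c where "c = 2 / (w \<bullet> w)"
  have cww: "c * (w \<bullet> w) = 2" using ww by (simp add: c_def)
  \<comment> \<open>Since \<open>v\<close> and \<open>e\<^sub>0\<close> are unit vectors, \<open>w \<bullet> w = -2 w\<^sub>0\<close>; this makes the first column equal to \<open>e\<^sub>0 + w = v\<close>.\<close>
  have "w \<bullet> w = 2 - 2 * v $ 0"
    using v n by (simp add: w_def scalar_prod_minus_distrib[of _ n] minus_scalar_prod_distrib[of _ n])
  moreover have "w $ 0 = v $ 0 - 1" using v n by (simp add: w_def)
  ultimately have "w \<bullet> w = -2 * w $ 0" by simp
  then have c0: "c * w $ 0 = -1" using cww by simp
  define H where "H = mat n n (\<lambda>(i,j). (if i = j then 1 else 0) - c * w $ i * w $ j)"
  have H: "H \<in> carrier_mat n n" by (simp add: H_def)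
  have "H * H = 1\<^sub>m n"
  proof (rule eq_matI)
    fix i j assume "i < dim_row (1\<^sub>m n :: real mat)" "j < dim_col (1\<^sub>m n :: real mat)"
    then have ij: "i < n" "j < n" by auto
    have "(H * H) $$ (i, j) =
      (\<Sum>l = 0..<n. ((if i = l then 1 else 0) - c * w $ i * w $ l) * ((if l = j then 1 else 0) - c * w $ l * w $ j))"
      using ij by (simp add: H_def scalar_prod_def)
    also have "\<dots> = (\<Sum>l = 0..<n. (if l = i then (if l = j then 1 else 0) - c * w $ l * w $ j else 0)
        - (if l = j then c * w $ i * w $ l else 0)
        + c * w $ i * w $ j * c * (w $ l * w $ l))"
      by (rule sum.cong) (auto simp: algebra_simps)
    also have "\<dots> = ((if i = j then 1 else 0) - c * w $ i * w $ j) - c * w $ i * w $ j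
        + c * w $ i * w $ j * (c * (w \<bullet> w))"
      using ij w by (simp add: sum.distrib sum_subtractf sum_distrib_left[symmetric] scalar_prod_def)
    also have "\<dots> = 1\<^sub>m n $$ (i, j)" using ij by (simp add: cww)
    finally show "(H * H) $$ (i, j) = 1\<^sub>m n $$ (i, j)" .
  qed (auto simp: H_def)
  moreover have "H\<^sup>T = H" by (rule eq_matI) (auto simp: H_def)
  moreover have "col H 0 = v"
  proof (rule eq_vecI)
    fix i assume "i < dim_vec v"
    then have i: "i < n" using v by auto
    have "col H 0 $ i = (if i = 0 then 1 else 0) - (c * w $ 0) * w $ i"
      using i n by (simp add: H_def)
    also have "\<dots> = v $ i" unfolding c0 using i v n by (simp add: w_def)
    finally show "col H 0 $ i = v $ i" .
  qed (use v H in auto)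
  ultimately show ?thesis using H by blast
qed

text \<open>By deflation: a Householder reflection \<open>H\<close> that moves \<open>e\<^sub>0\<close> to a unit eigenvector turns \<open>M\<close> into \<open>H M H\<close>,
  whose first column, and by symmetry also first row, vanishes off the diagonal. The induction
  hypothesis then diagonalizes the remaining block.\<close>

lemma spectral_theorem_symmetric:
  fixes M :: "real mat"
  assumes "M \<in> carrier_mat n n" "M\<^sup>T = M"
  shows "\<exists>U d. U \<in> carrier_mat n n \<and> U\<^sup>T * U = 1\<^sub>m n \<and> M * U = U * mat_diag n d"
  using assms
proof (induction n arbitrary: M)
  case 0
  then show ?case by (intro exI[of _ "0\<^sub>m 0 0"] exI[of _ "\<lambda>_. 0"] conjI eq_matI)
      (auto simp: mat_diag_def)
next
  case (Suc n)
  note M = Suc.prems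
  obtain ev v where v: "v \<in> carrier_vec (Suc n)" "v \<bullet> v = 1" "M *\<^sub>v v = ev \<cdot>\<^sub>v v"
    using symmetric_real_eigenvector[OF M] by auto
  obtain H where H: "H \<in> carrier_mat (Suc n) (Suc n)" "H\<^sup>T = H" "H * H = 1\<^sub>m (Suc n)" "col H 0 = v"
    using householder_reflection[OF v(1,2)] by auto
  define N where "N = H * (M * H)"
  have N: "N \<in> carrier_mat (Suc n) (Suc n)" using H M by (auto simp: N_def)
  have MH: "M * H \<in> carrier_mat (Suc n) (Suc n)" using H M by auto
  have Nsym: "N\<^sup>T = N"
    using H M MH
    by (simp add: N_def transpose_mult[OF H(1) MH] transpose_mult[OF M(1) H(1)] assoc_mult_mat[OF H(1) M(1) H(1)])
  have "col N 0 = H *\<^sub>v (M *\<^sub>v col H 0)"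
    unfolding N_def using col_mult2[OF H(1) MH, of 0] col_mult2[OF M(1) H(1), of 0] by simp
  also have "\<dots> = ev \<cdot>\<^sub>v (H *\<^sub>v col H 0)" using v H by (simp add: mult_mat_vec[OF H(1) v(1)])
  also have "H *\<^sub>v col H 0 = col (H * H) 0" using col_mult2[OF H(1) H(1), of 0] by simp
  also have "\<dots> = unit_vec (Suc n) 0" using H by simp
  finally have col0: "col N 0 = ev \<cdot>\<^sub>v unit_vec (Suc n) 0" .
  have Ni0: "N $$ (i, 0) = (if i = 0 then ev else 0)" if "i < Suc n" for i
    using arg_cong[OF col0, of "\<lambda>u. u $ i"] that N by (auto simp: unit_vec_def)
  have N0j: "N $$ (0, j) = (if j = 0 then ev else 0)" if "j < Suc n" for j
    using arg_cong[OF Nsym, of "\<lambda>K. K $$ (0, j)"] Ni0[OF that] that N by auto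
  define M' where "M' = mat n n (\<lambda>(i,j). N $$ (Suc i, Suc j))"
  have M': "M' \<in> carrier_mat n n" by (simp add: M'_def)
  have "N $$ (Suc j, Suc i) = N $$ (Suc i, Suc j)" if "i < n" "j < n" for i j
    using arg_cong[OF Nsym, of "\<lambda>K. K $$ (Suc i, Suc j)"] that N by auto
  then have "M'\<^sup>T = M'" by (intro eq_matI) (auto simp: M'_def)
  from Suc.IH[OF M' this] obtain U' d' where U': "U' \<in> carrier_mat n n" "U'\<^sup>T * U' = 1\<^sub>m n"
    "M' * U' = U' * mat_diag n d'" by blast
  define d where "d = (\<lambda>i. case i of 0 \<Rightarrow> ev | Suc i \<Rightarrow> d' i)"
  let ?E = "mat 1 1 (\<lambda>_. ev)"
  have Nblock: "N = four_block_mat ?E (0\<^sub>m 1 n) (0\<^sub>m n 1) M'"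
    by (rule eq_matI) (use N Ni0 N0j in \<open>auto simp: M'_def\<close>)
  have Dblock: "mat_diag (Suc n) d = four_block_mat ?E (0\<^sub>m 1 n) (0\<^sub>m n 1) (mat_diag n d')"
    by (rule eq_matI) (auto simp: mat_diag_def d_def split: nat.split)
  define V where "V = four_block_mat (1\<^sub>m 1) (0\<^sub>m 1 n) (0\<^sub>m n 1) U'"
  have V: "V \<in> carrier_mat (Suc n) (Suc n)" using U' by (auto simp: V_def)
  have VV: "V\<^sup>T * V = 1\<^sub>m (Suc n)"
  proof -
    have "V\<^sup>T = four_block_mat (1\<^sub>m 1) (0\<^sub>m 1 n) (0\<^sub>m n 1) (U'\<^sup>T)"
      unfolding V_def by (subst transpose_four_block_mat[of _ 1 1 _ n _ n]) (use U' in auto)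
    then have "V\<^sup>T * V = four_block_mat (1\<^sub>m 1) (0\<^sub>m 1 n) (0\<^sub>m n 1) (U'\<^sup>T * U')"
      unfolding V_def by (simp, subst mult_four_block_mat[of _ 1 1 _ n _ n _ _ 1 _ n]) (use U' in auto)
    then show ?thesis using U'(2) by (auto intro!: eq_matI)
  qed
  have NV: "N * V = V * mat_diag (Suc n) d"
  proof -
    have E: "?E \<in> carrier_mat 1 1" by auto
    have "N * V = four_block_mat ?E (0\<^sub>m 1 n) (0\<^sub>m n 1) (M' * U')"
      unfolding Nblock V_def
      by (subst mult_four_block_mat[of _ 1 1 _ n _ n _ _ 1 _ n]) (use U' M' in auto)
    also have "\<dots> = V * mat_diag (Suc n) d"
      unfolding Dblock V_def U'(3)
      by (subst mult_four_block_mat[of _ 1 1 _ n _ n _ _ 1 _ n])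
        (use U' left_mult_zero_mat[OF mat_diag_dim, of 1 n d'] in auto)
    finally show ?thesis .
  qed
  have HV: "H * V \<in> carrier_mat (Suc n) (Suc n)" using H V by auto
  have HHV: "H * (H * V) = V" using assoc_mult_mat[OF H(1) H(1) V] H(3) V by simp
  have "(H * V)\<^sup>T * (H * V) = V\<^sup>T * (H * (H * V))"
    using H V HV by (simp add: transpose_mult[OF H(1) V] assoc_mult_mat[of _ "Suc n" "Suc n" _ "Suc n" _ "Suc n"])
  then have "(H * V)\<^sup>T * (H * V) = 1\<^sub>m (Suc n)" using HHV VV by simp
  moreover have "M * (H * V) = (H * V) * mat_diag (Suc n) d"
  proof -
    have "(H * V) * mat_diag (Suc n) d = H * (N * V)"
      unfolding NV by (rule assoc_mult_mat[OF H(1) V mat_diag_dim])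
    also have "N * V = H * (M * (H * V))"
      unfolding N_def using assoc_mult_mat[OF H(1) MH V] assoc_mult_mat[OF M(1) H(1) V] by simp
    also have "H * (H * (M * (H * V))) = M * (H * V)"
      using assoc_mult_mat[OF H(1) H(1) mult_carrier_mat[OF M(1) HV]] H(3) M(1) HV by simp
    finally show ?thesis ..
  qed
  ultimately show ?case using HV by blast
qed

section \<open>Positive definite matrices and the preconditioned eigenbasis\<close>

lemma spd_carrier: "spd n M \<Longrightarrow> M \<in> carrier_mat n n"
  and spd_symmetric: "spd n M \<Longrightarrow> M\<^sup>T = M"
  and spd_pos: "spd n M \<Longrightarrow> v \<in> carrier_vec n \<Longrightarrow> v \<noteq> 0\<^sub>v n \<Longrightarrow> 0 < v \<bullet> (M *\<^sub>v v)"
  by (auto simp: spd_def)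

lemma spd_nonneg:
  assumes "spd n M" "v \<in> carrier_vec n"
  shows "0 \<le> v \<bullet> (M *\<^sub>v v)"
  using spd_pos[OF assms] spd_carrier[OF assms(1)] assms(2) by (cases "v = 0\<^sub>v n") auto

lemma mat_diag_mult_vec:
  fixes v :: "'a :: semiring_0 vec"
  assumes "v \<in> carrier_vec n"
  shows "mat_diag n f *\<^sub>v v = vec n (\<lambda>i. f i * v $ i)"
proof (rule eq_vecI)
  fix i assume "i < dim_vec (vec n (\<lambda>i. f i * v $ i))"
  then have i: "i < n" by simp
  have "(mat_diag n f *\<^sub>v v) $ i = (\<Sum>j = 0..<n. (if i = j then f j else 0) * v $ j)"
    using i assms by (simp add: mat_diag_def scalar_prod_def)
  also have "\<dots> = (\<Sum>j = 0..<n. if i = j then f j * v $ j else 0)"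
    by (rule sum.cong) auto
  finally show "(mat_diag n f *\<^sub>v v) $ i = vec n (\<lambda>i. f i * v $ i) $ i" using i by simp
qed (simp add: mat_diag_def)

lemma mat_diag_quadratic_form:
  fixes v :: "real vec"
  assumes "v \<in> carrier_vec n"
  shows "v \<bullet> (mat_diag n f *\<^sub>v v) = (\<Sum>i<n. f i * (v $ i)\<^sup>2)"
  unfolding mat_diag_mult_vec[OF assms] using assms
  by (auto simp: scalar_prod_def atLeast0LessThan power2_eq_square intro!: sum.cong)

lemma spd_mat_diag:
  assumes "\<And>i. i < n \<Longrightarrow> 0 < f i"
  shows "spd n (mat_diag n f)"
proof -
  have "0 < v \<bullet> (mat_diag n f *\<^sub>v v)" if v: "v \<in> carrier_vec n" "v \<noteq> 0\<^sub>v n" for v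
  proof -
    have "\<exists>i<n. v $ i \<noteq> 0" using v by (auto intro!: eq_vecI)
    then obtain i where i: "i < n" "v $ i \<noteq> 0" by blast
    have "0 < f i * (v $ i)\<^sup>2" using i assms by simp
    also have "\<dots> \<le> (\<Sum>i<n. f i * (v $ i)\<^sup>2)"
      by (rule member_le_sum) (use i assms in \<open>auto simp: less_imp_le\<close>)
    finally show ?thesis by (simp add: mat_diag_quadratic_form[OF v(1)])
  qed
  moreover have "(mat_diag n f)\<^sup>T = mat_diag n f" by (rule eq_matI) (auto simp: mat_diag_def)
  ultimately show ?thesis by (simp add: spd_def)
qed

text \<open>This covers the projected matrix \<open>W\<^sup>T A W\<close>, the preconditioned matrix, and the square root built from an
  eigenbasis.\<close>

lemma spd_congruence:
  assumes M: "spd n M" and B: "B \<in> carrier_mat n k"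
    and inj: "\<And>v. v \<in> carrier_vec k \<Longrightarrow> B *\<^sub>v v = 0\<^sub>v n \<Longrightarrow> v = 0\<^sub>v k"
  shows "spd k (B\<^sup>T * M * B)"
proof -
  note Mc = spd_carrier[OF M]
  have BT: "B\<^sup>T \<in> carrier_mat k n" using B by simp
  have BM: "B\<^sup>T * M \<in> carrier_mat k n" using BT Mc by simp
  have "(B\<^sup>T * M * B)\<^sup>T = B\<^sup>T * M * B"
    unfolding transpose_mult[OF BM B] transpose_mult[OF BT Mc] spd_symmetric[OF M] transpose_transpose
    by (rule assoc_mult_mat[OF BT Mc B, symmetric])
  moreover have "0 < v \<bullet> ((B\<^sup>T * M * B) *\<^sub>v v)" if v: "v \<in> carrier_vec k" "v \<noteq> 0\<^sub>v k" for v
  proof -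
    have Bv: "B *\<^sub>v v \<in> carrier_vec n" "B *\<^sub>v v \<noteq> 0\<^sub>v n" using v inj B by auto
    have "v \<bullet> ((B\<^sup>T * M * B) *\<^sub>v v) = v \<bullet> (B\<^sup>T *\<^sub>v (M *\<^sub>v (B *\<^sub>v v)))"
      unfolding assoc_mult_mat_vec[OF BM B v(1)] assoc_mult_mat_vec[OF BT Mc Bv(1)] ..
    also have "\<dots> = (B *\<^sub>v v) \<bullet> (M *\<^sub>v (B *\<^sub>v v))"
      using transpose_vec_mult_scalar[OF B v(1), of "M *\<^sub>v (B *\<^sub>v v)"] Bv Mc v BT
        comm_scalar_prod[of v k "B\<^sup>T *\<^sub>v (M *\<^sub>v (B *\<^sub>v v))"]
        comm_scalar_prod[of "B *\<^sub>v v" n "M *\<^sub>v (B *\<^sub>v v)"]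
      by auto
    also have "0 < \<dots>" using spd_pos[OF M Bv] .
    finally show ?thesis .
  qed
  ultimately show ?thesis using BM B by (simp add: spd_def)
qed

text \<open>The inverse is chosen from an optional value, so its algebraic laws require first that the value
  is present. A trivial kernel is the form in which invertibility is available for all matrices below.\<close>

lemma mat_inv_if_trivial_kernel:
  assumes M: "M \<in> carrier_mat n n"
    and inj: "\<And>v. v \<in> carrier_vec n \<Longrightarrow> M *\<^sub>v v = 0\<^sub>v n \<Longrightarrow> v = 0\<^sub>v n"
  shows "M * mat_inv M = 1\<^sub>m n" "mat_inv M * M = 1\<^sub>m n" "mat_inv M \<in> carrier_mat n n"
proof -
  have "det M \<noteq> 0" using det_0_iff_vec_prod_zero_field[OF M] inj by blast
  then have "M \<in> Units (ring_mat TYPE(real) n ())" by (rule det_non_zero_imp_unit[OF M])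
  then obtain B where "mat_inverse M = Some B" using mat_inverse(1)[OF M] by fastforce
  then show "M * mat_inv M = 1\<^sub>m n" "mat_inv M * M = 1\<^sub>m n" "mat_inv M \<in> carrier_mat n n"
    using mat_inverse(2)[OF M] by (auto simp: mat_inv_def)
qed

lemma spd_trivial_kernel:
  assumes "spd n M" "v \<in> carrier_vec n" "M *\<^sub>v v = 0\<^sub>v n"
  shows "v = 0\<^sub>v n"
  using spd_pos[OF assms(1,2)] assms(2,3) by fastforce

lemmas spd_mat_inv = mat_inv_if_trivial_kernel[OF spd_carrier spd_trivial_kernel]

lemma orthonormal_eigenvectors:
  fixes M U :: "real mat"
  assumes M: "M \<in> carrier_mat n n" and U: "U \<in> carrier_mat n n" "U\<^sup>T * U = 1\<^sub>m n"
    and MU: "M * U = U * mat_diag n d" and i: "i < n"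
  shows "col U i \<in> carrier_vec n" "col U i \<bullet> col U i = 1" "M *\<^sub>v col U i = d i \<cdot>\<^sub>v col U i"
proof -
  show "col U i \<in> carrier_vec n" using U i by auto
  have "(U\<^sup>T * U) $$ (i, i) = col U i \<bullet> col U i" using U(1) i by simp
  then show "col U i \<bullet> col U i = 1" unfolding U(2) using i by simp
  have "M *\<^sub>v col U i = col (U * mat_diag n d) i"
    using col_mult2[OF M U(1) i] MU by simp
  also have "\<dots> = d i \<cdot>\<^sub>v col U i"
    unfolding mat_diag_mult_right[OF U(1)] using U i by (auto intro!: eq_vecI)
  finally show "M *\<^sub>v col U i = d i \<cdot>\<^sub>v col U i" .
qed

lemma spd_square_root_exists:
  assumes P: "spd n P"
  shows "\<exists>S. spd n S \<and> S * S = P"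
proof -
  note Pc = spd_carrier[OF P]
  obtain U d where U: "U \<in> carrier_mat n n" "U\<^sup>T * U = 1\<^sub>m n" "P * U = U * mat_diag n d"
    using spectral_theorem_symmetric[OF Pc spd_symmetric[OF P]] by blast
  have UT: "U\<^sup>T \<in> carrier_mat n n" using U by simp
  have UU: "U * U\<^sup>T = 1\<^sub>m n" using mat_mult_left_right_inverse[OF UT U(1,2)] .
  have d: "0 < d i" if "i < n" for i
  proof -
    note g = orthonormal_eigenvectors[OF Pc U that]
    have "col U i \<noteq> 0\<^sub>v n" using g(1,2) by auto
    from spd_pos[OF P g(1) this] show ?thesis using g by simp
  qed
  let ?D = "mat_diag n (\<lambda>i. sqrt (d i))"
  have D: "?D \<in> carrier_mat n n" by simp
  define S where "S = (U\<^sup>T)\<^sup>T * ?D * U\<^sup>T"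
  have "spd n S"
    unfolding S_def
  proof (rule spd_congruence[OF spd_mat_diag UT])
    fix v :: "real vec" assume v: "v \<in> carrier_vec n" "U\<^sup>T *\<^sub>v v = 0\<^sub>v n"
    have "v = U *\<^sub>v (U\<^sup>T *\<^sub>v v)" using v UU U UT by (metis assoc_mult_mat_vec one_mult_mat_vec)
    then show "v = 0\<^sub>v n" using v U by (auto intro!: eq_vecI)
  qed (use d in auto)
  moreover have "S * S = P"
  proof -
    note simps = assoc_mult_mat[of _ n n _ n _ n] mult_carrier_mat[of _ n n _ n] left_mult_one_mat[of _ n n]
    have "S * S = U * (?D * ((U\<^sup>T * U) * (?D * U\<^sup>T)))"
      using U(1) UT D by (simp add: S_def simps del: mat_diag_diag)
    also have "\<dots> = U * ((?D * ?D) * U\<^sup>T)"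
      unfolding U(2) using U(1) UT D by (simp add: simps del: mat_diag_diag)
    also have "?D * ?D = mat_diag n d"
      unfolding mat_diag_diag using d by (auto simp: mat_diag_def less_imp_le intro!: eq_matI)
    also have "U * (mat_diag n d * U\<^sup>T) = P * (U * U\<^sup>T)"
      using U UT Pc by (simp flip: assoc_mult_mat[of _ n n _ n _ n])
    also have "\<dots> = P" using UU Pc by simp
    finally show ?thesis .
  qed
  ultimately show ?thesis by blast
qed

text \<open>Let \<open>g\<close> be an eigenvector of \<open>S - R\<close> with eigenvalue \<open>e\<close>. From \<open>R\<^sup>2 = S\<^sup>2\<close> the vectors \<open>R g\<close> and
  \<open>S g = R g + e g\<close> have the same length. Comparing the squares gives \<open>e (g \<bullet> R g + g \<bullet> S g) = 0\<close>, and
  positivity forces \<open>e = 0\<close>. Hence the symmetric matrix \<open>S - R\<close> has only zero eigenvalues.\<close>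

lemma spd_square_root_unique:
  assumes R: "spd n R" and S: "spd n S" and RS: "R * R = S * S"
  shows "R = S"
proof -
  note Rc = spd_carrier[OF R] and Sc = spd_carrier[OF S]
  define E where "E = S - R"
  have E: "E \<in> carrier_mat n n" unfolding E_def by (rule minus_carrier_mat[OF Rc])
  have "E\<^sup>T = E" using R S by (simp add: E_def transpose_minus[OF Sc Rc] spd_symmetric)
  then obtain U e where U: "U \<in> carrier_mat n n" "U\<^sup>T * U = 1\<^sub>m n" "E * U = U * mat_diag n e"
    using spectral_theorem_symmetric[OF E] by blast
  have e0: "e i = 0" if i: "i < n" for i
  proof -
    define g where "g = col U i"
    note g = orthonormal_eigenvectors[OF E U i, folded g_def]
    have g0: "g \<noteq> 0\<^sub>v n" using g(1,2) by auto
    define p where "p = R *\<^sub>v g"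
    have p: "p \<in> carrier_vec n" using Rc g by (simp add: p_def)
    have "S = R + E" using Rc Sc by (auto simp: E_def intro!: eq_matI)
    then have Sg: "S *\<^sub>v g = p + e i \<cdot>\<^sub>v g"
      by (simp only: add_mult_distrib_mat_vec[OF Rc E g(1)] g(3) p_def)
    have "p \<bullet> p = g \<bullet> ((R * R) *\<^sub>v g)"
      using symmetric_scalar_prod[OF Rc spd_symmetric[OF R] g(1) p]
      by (simp add: p_def assoc_mult_mat_vec[OF Rc Rc g(1)])
    also have "\<dots> = (S *\<^sub>v g) \<bullet> (S *\<^sub>v g)"
      using symmetric_scalar_prod[OF Sc spd_symmetric[OF S] g(1), of "S *\<^sub>v g"] Sc g(1)
      by (simp add: RS assoc_mult_mat_vec[OF Sc Sc g(1)])
    also have "\<dots> = p \<bullet> p + e i * (g \<bullet> p + g \<bullet> (p + e i \<cdot>\<^sub>v g))"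
      unfolding Sg using p g(1)
      by (simp add: add_scalar_prod_distrib[of _ n] scalar_prod_add_distrib[of _ n]
          comm_scalar_prod[of p n g] algebra_simps)
    finally have "e i * (g \<bullet> (R *\<^sub>v g) + g \<bullet> (S *\<^sub>v g)) = 0" by (simp add: Sg p_def)
    moreover have "0 < g \<bullet> (R *\<^sub>v g)" "0 < g \<bullet> (S *\<^sub>v g)"
      using spd_pos[OF R g(1) g0] spd_pos[OF S g(1) g0] .
    ultimately show ?thesis by auto
  qed
  have UT: "U\<^sup>T \<in> carrier_mat n n" using U by simp
  have UU: "U * U\<^sup>T = 1\<^sub>m n" using mat_mult_left_right_inverse[OF UT U(1,2)] .
  have "mat_diag n e = 0\<^sub>m n n" using e0 by (auto simp: mat_diag_def intro!: eq_matI)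
  then have EU: "E * U = 0\<^sub>m n n" using U by simp
  have "E = (E * U) * U\<^sup>T" unfolding assoc_mult_mat[OF E U(1) UT] UU using E by simp
  then have "E = 0\<^sub>m n n" using EU UT by simp
  moreover have "S = R + E" using Rc Sc by (auto simp: E_def intro!: eq_matI)
  ultimately show ?thesis using Rc by simp
qed

lemma mat_sqrt:
  assumes P: "spd n P"
  shows "spd n (mat_sqrt P)" "mat_sqrt P * mat_sqrt P = P"
proof -
  have "\<exists>!S. spd (dim_row P) S \<and> S * S = P"
    using spd_square_root_exists[OF P] spd_square_root_unique spd_carrier[OF P] by fastforce
  from theI'[OF this] show "spd n (mat_sqrt P)" "mat_sqrt P * mat_sqrt P = P"
    using spd_carrier[OF P] by (auto simp: mat_sqrt_def)
qed

text \<open>With \<open>R = P\<^sup>-\<^sup>1\<^sup>/\<^sup>2\<close> and an orthogonal \<open>U\<close> that diagonalizes \<open>M = R A R\<close>, the columns of \<open>G = R U\<close> are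
  eigenvectors of \<open>Q A = R (R A R) R\<^sup>-\<^sup>1\<close>. Since \<open>G\<^sup>T A G = U\<^sup>T M U\<close>, the same basis also diagonalizes the energy
  form, and with the same entries. This is why a polynomial in \<open>Q A\<close> can be estimated in the energy norm by
  its values on the spectrum of \<open>M\<close> alone.\<close>

lemma preconditioned_eigenbasis:
  assumes A: "spd m A" and P: "spd m P" and Q: "Q \<in> carrier_mat m m" "Q * P = 1\<^sub>m m"
  defines "M \<equiv> mat_inv_sqrt P * A * mat_inv_sqrt P"
  shows "\<exists>G d. G \<in> carrier_mat m m \<and> (\<forall>x \<in> carrier_vec m. \<exists>c \<in> carrier_vec m. x = G *\<^sub>v c) \<and>
      Q * A * G = G * mat_diag m d \<and> G\<^sup>T * A * G = mat_diag m d \<and> (\<forall>i<m. d i \<in> spectrum M)"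
    and "spd m M"
proof -
  note simps = assoc_mult_mat[of _ m m _ m _ m] mult_carrier_mat[of _ m m _ m] left_mult_one_mat[of _ m m]
  define S where "S = mat_sqrt P"
  have S: "spd m S" and SS: "S * S = P" using mat_sqrt[OF P] by (auto simp: S_def)
  note Sc = spd_carrier[OF S] and Ac = spd_carrier[OF A]
  define R where "R = mat_inv S"
  have SR: "S * R = 1\<^sub>m m" and RS: "R * S = 1\<^sub>m m" and R: "R \<in> carrier_mat m m"
    using spd_mat_inv[OF S S] by (auto simp: R_def)
  have RT: "R\<^sup>T = R"
  proof -
    have "R\<^sup>T * S = 1\<^sub>m m"
      using arg_cong[OF SR, of transpose_mat] by (simp add: transpose_mult[OF Sc R] spd_symmetric[OF S])
    then have "R\<^sup>T * (S * R) = 1\<^sub>m m * R" using R Sc by (simp flip: assoc_mult_mat[of _ m m _ m _ m])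
    then show ?thesis using R SR by simp
  qed
  have QRR: "Q = R * R"
  proof -
    have "R * R = (Q * (S * S)) * (R * R)" using Q R SS by simp
    also have "\<dots> = Q * (S * ((S * R) * R))" using Q Sc R by (simp add: simps)
    also have "\<dots> = Q" unfolding SR using Q R Sc SR by simp
    finally show ?thesis ..
  qed
  have M: "M = R * A * R" by (simp add: M_def mat_inv_sqrt_def R_def S_def)
  have spdM: "spd m (R\<^sup>T * A * R)"
  proof (rule spd_congruence[OF A R])
    fix v :: "real vec" assume v: "v \<in> carrier_vec m" "R *\<^sub>v v = 0\<^sub>v m"
    have "v = S *\<^sub>v (R *\<^sub>v v)" using v SR Sc R by (metis assoc_mult_mat_vec one_mult_mat_vec)
    then show "v = 0\<^sub>v m" using v Sc by (auto intro!: eq_vecI)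
  qed
  then show "spd m M" by (simp add: M RT)
  note spdM' = this
  note Mc = spd_carrier[OF this]
  obtain U d where U: "U \<in> carrier_mat m m" "U\<^sup>T * U = 1\<^sub>m m" "M * U = U * mat_diag m d"
    using spectral_theorem_symmetric[OF Mc spd_symmetric[OF spdM']] by blast
  have UT: "U\<^sup>T \<in> carrier_mat m m" using U by simp
  have UU: "U * U\<^sup>T = 1\<^sub>m m" using mat_mult_left_right_inverse[OF UT U(1,2)] .
  have D: "mat_diag m d \<in> carrier_mat m m" by simp
  define G where "G = R * U"
  have G: "G \<in> carrier_mat m m" using R U by (simp add: G_def)
  have "\<exists>c \<in> carrier_vec m. x = G *\<^sub>v c" if x: "x \<in> carrier_vec m" for x
  proof (rule bexI)
    have "G * (U\<^sup>T * S) = R * ((U * U\<^sup>T) * S)" using R U(1) UT Sc by (simp add: G_def simps)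
    also have "\<dots> = 1\<^sub>m m" using UU RS Sc by simp
    finally show "x = G *\<^sub>v ((U\<^sup>T * S) *\<^sub>v x)"
      using x G UT Sc by (metis assoc_mult_mat_vec mult_carrier_mat one_mult_mat_vec)
    show "(U\<^sup>T * S) *\<^sub>v x \<in> carrier_vec m" using x UT Sc by auto
  qed
  moreover have "Q * A * G = G * mat_diag m d"
  proof -
    have "Q * A * G = R * (M * U)" using R Ac U(1) by (simp add: QRR M G_def simps)
    also have "\<dots> = G * mat_diag m d" unfolding U(3) using R U(1) D by (simp add: G_def simps)
    finally show ?thesis .
  qed
  moreover have "G\<^sup>T * A * G = mat_diag m d"
  proof -
    have "G\<^sup>T * A * G = U\<^sup>T * (M * U)"
      using R U(1) UT Ac by (simp add: G_def M transpose_mult[OF R U(1)] RT simps)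
    also have "\<dots> = (U\<^sup>T * U) * mat_diag m d" unfolding U(3) using U(1) UT D by (simp add: simps)
    also have "\<dots> = mat_diag m d" unfolding U(2) by (rule left_mult_one_mat[OF mat_diag_dim])
    finally show ?thesis .
  qed
  moreover have "d i \<in> spectrum M" if i: "i < m" for i
  proof -
    note g = orthonormal_eigenvectors[OF Mc U i]
    have "col U i \<noteq> 0\<^sub>v m" using g by auto
    with g Mc show ?thesis by (auto simp: spectrum_def eigenvalue_def eigenvector_def)
  qed
  ultimately show "\<exists>G d. G \<in> carrier_mat m m \<and> (\<forall>x \<in> carrier_vec m. \<exists>c \<in> carrier_vec m. x = G *\<^sub>v c) \<and>
      Q * A * G = G * mat_diag m d \<and> G\<^sup>T * A * G = mat_diag m d \<and> (\<forall>i<m. d i \<in> spectrum M)"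
    using G by blast
qed

lemma spd_spectrum_pos:
  assumes M: "spd n M" and k: "k \<in> spectrum M"
  shows "0 < k"
proof -
  note Mc = spd_carrier[OF M]
  from k Mc obtain v where v: "v \<in> carrier_vec n" "v \<noteq> 0\<^sub>v n" "M *\<^sub>v v = k \<cdot>\<^sub>v v"
    by (auto simp: spectrum_def eigenvalue_def eigenvector_def)
  have "0 < k * (v \<bullet> v)" using spd_pos[OF M v(1,2)] v by simp
  then show ?thesis using scalar_prod_self_pos[OF v(1,2)] by (simp add: zero_less_mult_iff)
qed

section \<open>Chebyshev polynomials\<close>

fun chebyshev :: "nat \<Rightarrow> real poly" where
  "chebyshev 0 = 1"
| "chebyshev (Suc 0) = [:0, 1:]"
| "chebyshev (Suc (Suc n)) = [:0, 2:] * chebyshev (Suc n) - chebyshev n"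

lemma degree_chebyshev_le: "degree (chebyshev n) \<le> n"
proof (induction n rule: chebyshev.induct)
  case (3 n)
  have "degree ([:0, 2:] * chebyshev (Suc n)) \<le> degree [:0, 2::real:] + degree (chebyshev (Suc n))"
    by (rule degree_mult_le)
  with 3 show ?case by (auto intro!: degree_diff_le)
qed auto

lemma chebyshev_cos: "poly (chebyshev n) (cos t) = cos (real n * t)"
proof (induction n rule: chebyshev.induct)
  case (3 n)
  have "cos (real (Suc (Suc n)) * t) + cos (real n * t) = 2 * cos t * cos (real (Suc n) * t)"
    using cos_add[of "real (Suc n) * t" t] cos_diff[of "real (Suc n) * t" t]
    by (simp add: algebra_simps)
  with 3 show ?case by simp
qed auto

text \<open>The hyperbolic counterpart of \<open>chebyshev_cos\<close>. It gives the growth of the polynomials outside of \<open>[-1, 1]\<close>.\<close>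

lemma chebyshev_joukowski:
  assumes "z * w = 1"
  shows "poly (chebyshev n) ((z + w) / 2) = (z ^ n + w ^ n) / 2"
proof (induction n rule: chebyshev.induct)
  case (3 n)
  have "(z + w) * (z ^ Suc n + w ^ Suc n) = z ^ Suc (Suc n) + w ^ Suc (Suc n) + (z * w) * (z ^ n + w ^ n)"
    by (simp add: algebra_simps)
  then have "(z + w) * (z ^ Suc n + w ^ Suc n) = z ^ Suc (Suc n) + w ^ Suc (Suc n) + (z ^ n + w ^ n)"
    using assms by simp
  moreover have "poly (chebyshev (Suc (Suc n))) ((z + w) / 2)
      = ((z + w) * (z ^ Suc n + w ^ Suc n) - (z ^ n + w ^ n)) / 2"
    using 3 by (simp add: field_simps)
  ultimately show ?case by simp
qed auto

text \<open>Take \<open>p(t) = T\<^sub>j(u(t)) / T\<^sub>j(u(0))\<close>, where \<open>T\<^sub>j\<close> is the Chebyshev polynomial and the affine map \<open>u\<close> carries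
  \<open>[a, b]\<close> onto \<open>[-1, 1]\<close> and \<open>0\<close> to
  \<open>(b + a) / (b - a)\<close>. The numerator is at most one on the interval. The denominator is at
  least \<open>\<rho>\<^sup>-\<^sup>j / 2\<close> by the Joukowski formula, where \<open>\<rho> = (\<surd>\<kappa> - 1) / (\<surd>\<kappa> + 1)\<close>. As \<open>p(0) = 1\<close>, such a \<open>p\<close>
  has the form \<open>1 - t q(t)\<close>. For \<open>a = b\<close> the map \<open>u\<close> degenerates, and for \<open>j > 0\<close> a linear \<open>p\<close> with root \<open>a\<close> replaces it.
  The case \<open>q = 0\<close> is separate because the zero polynomial has degree \<open>0\<close>, which is not below \<open>j = 0\<close>.\<close>

lemma chebyshev_residual_polynomial:
  fixes a b :: real
  assumes a: "0 < a" and ab: "a \<le> b"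
  defines "\<kappa> \<equiv> b / a"
  shows "\<exists>q. (q = 0 \<or> degree q < j) \<and>
    (\<forall>t \<in> {a..b}. \<bar>1 - t * poly q t\<bar> \<le> 2 * ((sqrt \<kappa> - 1) / (sqrt \<kappa> + 1)) ^ j)"
proof (cases "a = b")
  case True
  show ?thesis
  proof (cases j)
    case 0
    then show ?thesis by (intro exI[of _ 0]) auto
  next
    case (Suc i)
    then show ?thesis using True a by (intro exI[of _ "[:1 / a:]"]) (auto simp: \<kappa>_def)
  qed
next
  case False
  then have lt: "a < b" using ab by simp
  define r where "r = sqrt \<kappa>"
  have r: "1 < r" using lt a by (simp add: r_def \<kappa>_def)
  have rr: "r * r * a = b" using a ab by (simp add: r_def \<kappa>_def)
  define \<rho> where "\<rho> = (r - 1) / (r + 1)"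
  have \<rho>: "0 < \<rho>" using r by (simp add: \<rho>_def)
  have "(b + a) / (b - a) = (r * r + 1) / (r * r - 1)"
  proof -
    have "r * r - 1 > 0" using r by (simp add: less_1_mult)
    then show ?thesis using a lt unfolding rr[symmetric] by (simp add: field_simps)
  qed
  also have "\<dots> = (1 / \<rho> + \<rho>) / 2"
  proof -
    have "r * r - 1 = (r - 1) * (r + 1)" by (simp add: algebra_simps)
    then show ?thesis using r by (simp add: \<rho>_def divide_simps) (simp add: algebra_simps)
  qed
  finally have x0: "(b + a) / (b - a) = (1 / \<rho> + \<rho>) / 2" .
  define c where "c = poly (chebyshev j) ((b + a) / (b - a))"
  have c: "c = ((1 / \<rho>) ^ j + \<rho> ^ j) / 2"
    unfolding c_def x0 using \<rho> by (intro chebyshev_joukowski) simp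
  have c_ge: "(1 / \<rho>) ^ j / 2 \<le> c" using \<rho> by (simp add: c)
  have pos: "0 < (1 / \<rho>) ^ j / 2" using \<rho> by simp
  have c_pos: "0 < c" using c_ge pos by linarith
  have "1 / c \<le> 1 / ((1 / \<rho>) ^ j / 2)"
    using c_ge pos c_pos by (intro divide_left_mono mult_pos_pos) auto
  then have inv_c: "1 / c \<le> 2 * \<rho> ^ j" by (simp add: power_one_over)
  define p where "p = Polynomial.smult (1 / c) (chebyshev j \<circ>\<^sub>p [:(b + a) / (b - a), - 2 / (b - a):])"
  have "degree p \<le> j"
    using degree_pcompose_le[of "chebyshev j" "[:(b + a) / (b - a), - 2 / (b - a):]"] degree_chebyshev_le[of j]
      mult_le_mono[OF degree_chebyshev_le[of j], of "degree [:(b + a) / (b - a), - 2 / (b - a):]" 1]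
    by (auto simp: p_def intro: order_trans[OF degree_smult_le])
  have p0: "poly p 0 = 1" using c_pos by (simp add: p_def poly_pcompose c_def)
  have p_bound: "\<bar>poly p t\<bar> \<le> 2 * \<rho> ^ j" if t: "t \<in> {a..b}" for t
  proof -
    define u where "u = (b + a) / (b - a) + t * (- 2 / (b - a))"
    have u: "u = (b + a - 2 * t) / (b - a)" by (simp add: u_def diff_divide_distrib)
    have "-1 \<le> u" "u \<le> 1"
      unfolding u using t lt by (simp_all add: pos_le_divide_eq pos_divide_le_eq del: minus_diff_eq)
    then have "poly (chebyshev j) u = cos (real j * arccos u)"
      using chebyshev_cos[of j "arccos u"] by simp
    then have "\<bar>poly (chebyshev j) u\<bar> \<le> 1" by simp
    moreover have "poly p t = poly (chebyshev j) u / c" by (simp add: p_def poly_pcompose u_def)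
    ultimately have "\<bar>poly p t\<bar> \<le> 1 / c" using c_pos by (simp add: abs_divide divide_right_mono)
    with inv_c show ?thesis by linarith
  qed
  obtain e q' where pq: "p = pCons e q'" by (cases p)
  have e: "e = 1" using p0 pq by simp
  have "q' = 0 \<or> degree q' < j" using \<open>degree p \<le> j\<close> pq by (auto split: if_splits)
  then show ?thesis
    using p_bound pq e
    by (intro exI[of _ "- q'"]) (auto simp: \<rho>_def r_def)
qed

section \<open>Galerkin approximation in the energy norm\<close>

text \<open>Completing the square. With \<open>h = T\<^sup>-\<^sup>1 f\<close>, the squared energy norm of \<open>x - W w\<close> equals
  \<open>\<delta> + (w - h) \<bullet> T (w - h)\<close> for every \<open>w\<close>. Hence \<open>\<delta>\<close> is a lower bound that is attained at \<open>w = h\<close>.\<close>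

lemma galerkin_energy_error:
  fixes A W T :: "real mat" and x :: "real vec"
  assumes A: "spd m A" and W: "W \<in> carrier_mat m r" "W\<^sup>T * W = 1\<^sub>m r"
    and T: "T = W\<^sup>T * A * W" and x: "x \<in> carrier_vec m"
  defines "f \<equiv> W\<^sup>T *\<^sub>v (A *\<^sub>v x)"
  defines "\<delta> \<equiv> x \<bullet> (A *\<^sub>v x) - f \<bullet> (mat_inv T *\<^sub>v f)"
  shows "0 \<le> \<delta>" "w \<in> carrier_vec r \<Longrightarrow> \<delta> \<le> (x - W *\<^sub>v w) \<bullet> (A *\<^sub>v (x - W *\<^sub>v w))"
    and "spd r T"
proof -
  note Ac = spd_carrier[OF A]
  have WT: "W\<^sup>T \<in> carrier_mat r m" using W by simp
  have WTA: "W\<^sup>T * A \<in> carrier_mat r m" using WT Ac by simp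
  have Ax: "A *\<^sub>v x \<in> carrier_vec m" using Ac x by simp
  have f: "f \<in> carrier_vec r" unfolding f_def by (rule mult_mat_vec_carrier[OF WT Ax])
  show spdT: "spd r T"
    unfolding T
  proof (rule spd_congruence[OF A W(1)])
    fix v :: "real vec" assume v: "v \<in> carrier_vec r" "W *\<^sub>v v = 0\<^sub>v m"
    have "v = W\<^sup>T *\<^sub>v (W *\<^sub>v v)" using v(1) W WT by (metis assoc_mult_mat_vec one_mult_mat_vec)
    then show "v = 0\<^sub>v r" using v WT by (auto intro!: eq_vecI)
  qed
  note Tc = spd_carrier[OF spdT]
  note Tinv = spd_mat_inv[OF spdT spdT]
  define h where "h = mat_inv T *\<^sub>v f"
  have h: "h \<in> carrier_vec r" unfolding h_def by (rule mult_mat_vec_carrier[OF Tinv(3) f])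
  have Th: "T *\<^sub>v h = f"
    using assoc_mult_mat_vec[OF Tc Tinv(3) f] Tinv(1) f by (simp add: h_def)
  have error: "(x - W *\<^sub>v w) \<bullet> (A *\<^sub>v (x - W *\<^sub>v w)) = \<delta> + (w - h) \<bullet> (T *\<^sub>v (w - h))"
    if w: "w \<in> carrier_vec r" for w
  proof -
    define z where "z = W *\<^sub>v w"
    have z: "z \<in> carrier_vec m" unfolding z_def by (rule mult_mat_vec_carrier[OF W(1) w])
    have Az: "A *\<^sub>v z \<in> carrier_vec m" using Ac z by simp
    have Tw: "T *\<^sub>v w \<in> carrier_vec r" using Tc w by simp
    have "z \<bullet> (A *\<^sub>v x) = (A *\<^sub>v x) \<bullet> z" by (rule comm_scalar_prod[OF z Ax])
    also have "\<dots> = f \<bullet> w"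
      using transpose_vec_mult_scalar[OF W(1) w Ax] by (simp add: f_def z_def)
    finally have zx: "z \<bullet> (A *\<^sub>v x) = f \<bullet> w" .
    have xz: "x \<bullet> (A *\<^sub>v z) = f \<bullet> w"
      using symmetric_scalar_prod[OF Ac spd_symmetric[OF A] x z] comm_scalar_prod[OF z Ax] zx by simp
    have "T *\<^sub>v w = W\<^sup>T *\<^sub>v (A *\<^sub>v z)"
      unfolding T z_def assoc_mult_mat_vec[OF WTA W(1) w]
      by (rule assoc_mult_mat_vec[OF WT Ac mult_mat_vec_carrier[OF W(1) w]])
    then have zz: "z \<bullet> (A *\<^sub>v z) = w \<bullet> (T *\<^sub>v w)"
      using transpose_vec_mult_scalar[OF W(1) w Az] comm_scalar_prod[OF z Az] comm_scalar_prod[OF w Tw]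
      by (simp add: z_def)
    have hw: "h \<bullet> (T *\<^sub>v w) = f \<bullet> w"
      using symmetric_scalar_prod[OF Tc spd_symmetric[OF spdT] h w] Th by simp
    have "(x - z) \<bullet> (A *\<^sub>v (x - z)) = x \<bullet> (A *\<^sub>v x) - 2 * (f \<bullet> w) + w \<bullet> (T *\<^sub>v w)"
      using x z Ax Az
      by (simp add: mult_minus_distrib_mat_vec[OF Ac x z] minus_scalar_prod_distrib[of _ m]
          scalar_prod_minus_distrib[of _ m] zx xz zz)
    moreover have "(w - h) \<bullet> (T *\<^sub>v (w - h)) = w \<bullet> (T *\<^sub>v w) - 2 * (f \<bullet> w) + f \<bullet> h"
      using w h Tw f
      by (simp add: mult_minus_distrib_mat_vec[OF Tc w h] minus_scalar_prod_distrib[of _ r]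
          scalar_prod_minus_distrib[of _ r] Th hw comm_scalar_prod[OF w f] comm_scalar_prod[OF h f])
    ultimately show ?thesis by (simp add: z_def \<delta>_def h_def)
  qed
  show "\<delta> \<le> (x - W *\<^sub>v w) \<bullet> (A *\<^sub>v (x - W *\<^sub>v w))" if w: "w \<in> carrier_vec r"
    unfolding error[OF w] using spd_nonneg[OF spdT minus_carrier_vec[OF w h]] by simp
  have "h - h = 0\<^sub>v r" using h by (auto intro!: eq_vecI)
  then have "\<delta> = (x - W *\<^sub>v h) \<bullet> (A *\<^sub>v (x - W *\<^sub>v h))"
    using error[OF h] Tc by simp
  also have "0 \<le> \<dots>"
    by (rule spd_nonneg[OF A minus_carrier_vec[OF x mult_mat_vec_carrier[OF W(1) h]]])
  finally show "0 \<le> \<delta>" .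
qed

section \<open>Krylov subspaces\<close>

lemma vec_span_carrier:
  assumes "S \<subseteq> carrier_vec m"
  shows "vec_span m S \<subseteq> carrier_vec m"
proof -
  interpret vec_space "TYPE(real)" m .
  show ?thesis unfolding vec_span_def using assms by (rule span_is_subset2[unfolded module_vec_simps])
qed

lemma vec_span_superset:
  assumes "S \<subseteq> carrier_vec m"
  shows "S \<subseteq> vec_span m S"
proof -
  interpret vec_space "TYPE(real)" m .
  show ?thesis unfolding vec_span_def using assms by (rule in_own_span[unfolded module_vec_simps])
qed

lemma vec_span_mono: "S \<subseteq> S' \<Longrightarrow> vec_span m S \<subseteq> vec_span m S'"
proof -
  interpret vec_space "TYPE(real)" m .
  show "S \<subseteq> S' \<Longrightarrow> vec_span m S \<subseteq> vec_span m S'" unfolding vec_span_def by (rule span_is_monotone)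
qed

lemma vec_span_zero: "0\<^sub>v m \<in> vec_span m S"
proof -
  interpret vec_space "TYPE(real)" m .
  show ?thesis unfolding vec_span_def using span_zero[of S] by simp
qed

lemma vec_span_add:
  assumes "S \<subseteq> carrier_vec m" "u \<in> vec_span m S" "v \<in> vec_span m S"
  shows "u + v \<in> vec_span m S"
proof -
  interpret vec_space "TYPE(real)" m .
  show ?thesis using span_add1[of S u v] assms unfolding vec_span_def by simp
qed

lemma vec_span_smult:
  assumes "S \<subseteq> carrier_vec m" "v \<in> vec_span m S"
  shows "c \<cdot>\<^sub>v v \<in> vec_span m S"
proof -
  interpret vec_space "TYPE(real)" m .
  show ?thesis using smult_in_span[of S v c] assms unfolding vec_span_def by simp
qed

lemma vec_span_mult_mat_vec:
  fixes B :: "real mat"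
  assumes B: "B \<in> carrier_mat n m" and S: "S \<subseteq> carrier_vec m" and S': "S' \<subseteq> carrier_vec n"
    and gens: "\<And>v. v \<in> S \<Longrightarrow> B *\<^sub>v v \<in> vec_span n S'" and v: "v \<in> vec_span m S"
  shows "B *\<^sub>v v \<in> vec_span n S'"
proof -
  interpret vec_space "TYPE(real)" m .
  let ?N = "{v \<in> carrier_vec m. B *\<^sub>v v \<in> vec_span n S'}"
  have "submodule class_ring ?N V"
  proof (rule submodule.intro)
    show "Module.module class_ring V" ..
    show "?N \<subseteq> carrier V" by auto
    have "B *\<^sub>v 0\<^sub>v m = 0\<^sub>v n" using B by (auto intro!: eq_vecI)
    then show "\<zero>\<^bsub>V\<^esub> \<in> ?N" using vec_span_zero[of n S'] by simp
  next
    fix u v assume "u \<in> ?N" "v \<in> ?N"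
    then show "u \<oplus>\<^bsub>V\<^esub> v \<in> ?N"
      using vec_span_add[OF S'] by (auto simp: mult_add_distrib_mat_vec[OF B])
  next
    fix c :: real and u assume "c \<in> carrier class_ring" "u \<in> ?N"
    then show "c \<odot>\<^bsub>V\<^esub> u \<in> ?N"
      using vec_span_smult[OF S'] by (auto simp: mult_mat_vec[OF B])
  qed
  then have "vec_span m S \<subseteq> ?N"
    unfolding vec_span_def using S gens by (intro span_is_subset) (auto simp: vec_span_def)
  then show ?thesis using v by auto
qed

lemma vec_span_subset:
  assumes "S \<subseteq> vec_span m S'" "S' \<subseteq> carrier_vec m"
  shows "vec_span m S \<subseteq> vec_span m S'"
proof -
  interpret vec_space "TYPE(real)" m .
  show ?thesis using span_subsetI[of S' S] assms unfolding vec_span_def by simp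
qed

lemma mat_range_eq_vec_span:
  assumes "B \<in> carrier_mat m n"
  shows "mat_range B = vec_span m (set (cols B))"
proof -
  interpret vec_space "TYPE(real)" m .
  have "mat_range B = col_space B" using assms by (auto simp: mat_range_def col_space_eq[OF assms])
  then show ?thesis by (simp add: col_space_def vec_span_def)
qed

text \<open>Matrix powers unfold with the extra factor on the right; Krylov vectors need it on the left.\<close>

lemma pow_mat_Suc_mult_vec:
  fixes A :: "real mat"
  assumes A: "A \<in> carrier_mat m m" and v: "v \<in> carrier_vec m"
  shows "A ^\<^sub>m Suc l *\<^sub>v v = A *\<^sub>v (A ^\<^sub>m l *\<^sub>v v)"
  using v
proof (induction l arbitrary: v)
  case 0
  then show ?case using A by simp
next
  case (Suc l)
  have "A ^\<^sub>m Suc (Suc l) *\<^sub>v v = A ^\<^sub>m Suc l *\<^sub>v (A *\<^sub>v v)"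
    using assoc_mult_mat_vec[OF pow_carrier_mat[OF A] A Suc.prems, of "Suc l"] by simp
  also have "\<dots> = A *\<^sub>v (A ^\<^sub>m l *\<^sub>v (A *\<^sub>v v))" by (rule Suc.IH) (use A Suc.prems in simp)
  also have "A ^\<^sub>m l *\<^sub>v (A *\<^sub>v v) = A ^\<^sub>m Suc l *\<^sub>v v"
    using assoc_mult_mat_vec[OF pow_carrier_mat[OF A] A Suc.prems, of l] by simp
  finally show ?case .
qed

text \<open>Generators of the sum \<open>K\<^sub>i(A, y) + K\<^sub>j(A, \<Omega>)\<close>. The two lengths are kept apart because the preconditioner
  enlarges only the part that comes from \<open>\<Omega>\<close>.\<close>

definition joint_krylov_vectors :: "real mat \<Rightarrow> real vec \<Rightarrow> real mat \<Rightarrow> nat \<Rightarrow> nat \<Rightarrow> real vec set" where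
  "joint_krylov_vectors A y \<Omega> i j =
     {A ^\<^sub>m l *\<^sub>v y | l. l < i} \<union> {A ^\<^sub>m l *\<^sub>v w | l w. l < j \<and> w \<in> set (cols \<Omega>)}"

lemma joint_krylov_vectors_carrier:
  assumes "A \<in> carrier_mat m m" "y \<in> carrier_vec m" "\<Omega> \<in> carrier_mat m n"
  shows "joint_krylov_vectors A y \<Omega> i j \<subseteq> carrier_vec m"
  using assms cols_dim[of \<Omega>] mult_mat_vec_carrier[OF pow_carrier_mat[OF assms(1)]]
  by (auto simp: joint_krylov_vectors_def)

lemma set_krylov_cols:
  assumes A: "A \<in> carrier_mat m m" and Z: "Z \<in> carrier_mat m n"
  shows "set (krylov_cols A Z j) = {A ^\<^sub>m l *\<^sub>v w | l w. l < j \<and> w \<in> set (cols Z)}"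
proof -
  have "set (cols (A ^\<^sub>m l * Z)) = (\<lambda>w. A ^\<^sub>m l *\<^sub>v w) ` set (cols Z)" for l
    using col_mult2[OF pow_carrier_mat[OF A] Z] A Z by (force simp: cols_def)
  then show ?thesis by (auto simp: krylov_cols_def) blast
qed

text \<open>Multiplication by \<open>A\<close> lengthens both Krylov sequences by one. Multiplication by \<open>I + X\<close> adds an
  element of \<open>K\<^sub>s\<^sub>+\<^sub>1(A, \<Omega>)\<close>, which is already contained once the second sequence has at least \<open>s + 1\<close> terms.
  So the lead of the \<open>\<Omega>\<close>-part over the \<open>y\<close>-part stays equal to \<open>s\<close>.\<close>

lemma joint_krylov_step:
  assumes A: "A \<in> carrier_mat m m" and y: "y \<in> carrier_vec m" and \<Omega>: "\<Omega> \<in> carrier_mat m n"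
    and X: "X \<in> carrier_mat m m" "mat_range X \<subseteq> krylov A \<Omega> (s + 1)"
  defines "L \<equiv> \<lambda>i j. vec_span m (joint_krylov_vectors A y \<Omega> i j)"
  shows "(1\<^sub>m m + X) *\<^sub>v y \<in> L 1 (s + 1)"
    and "v \<in> L i (s + i) \<Longrightarrow> (1\<^sub>m m + X) *\<^sub>v (A *\<^sub>v v) \<in> L (Suc i) (s + Suc i)"
proof -
  note carrier = joint_krylov_vectors_carrier[OF A y \<Omega>]
  have mono: "L i j \<subseteq> L i' j'" if "i \<le> i'" "j \<le> j'" for i j i' j'
    unfolding L_def using that by (intro vec_span_mono) (force simp: joint_krylov_vectors_def)
  have Xv: "X *\<^sub>v v \<in> L (Suc i) (s + Suc i)" if "v \<in> carrier_vec m" for v i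
  proof -
    have "X *\<^sub>v v \<in> krylov A \<Omega> (s + 1)" using X that by (auto simp: mat_range_def)
    also have "\<dots> = L 0 (s + 1)"
      using A by (simp add: krylov_def L_def set_krylov_cols[OF A \<Omega>] joint_krylov_vectors_def)
    also have "\<dots> \<subseteq> L (Suc i) (s + Suc i)" by (rule mono) auto
    finally show ?thesis .
  qed
  have preconditioner: "(1\<^sub>m m + X) *\<^sub>v v \<in> L (Suc i) (s + Suc i)"
    if "v \<in> carrier_vec m" "v \<in> L (Suc i) (s + Suc i)" for v i
    using that vec_span_add[OF carrier] Xv
    by (simp add: add_mult_distrib_mat_vec[OF one_carrier_mat X(1)] L_def)
  have "y \<in> joint_krylov_vectors A y \<Omega> 1 (s + 1)"
    using y A by (auto simp: joint_krylov_vectors_def intro!: exI[of _ 0])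
  then have "y \<in> L (Suc 0) (s + Suc 0)" using vec_span_superset[OF carrier] by (auto simp: L_def)
  then show "(1\<^sub>m m + X) *\<^sub>v y \<in> L 1 (s + 1)" using preconditioner[OF y, of 0] by simp
  assume v: "v \<in> L i (s + i)"
  have vc: "v \<in> carrier_vec m" using v vec_span_carrier[OF carrier] by (auto simp: L_def)
  have "A *\<^sub>v v \<in> L (Suc i) (s + Suc i)"
    unfolding L_def
  proof (rule vec_span_mult_mat_vec[OF A carrier carrier _ v[unfolded L_def]])
    fix u assume "u \<in> joint_krylov_vectors A y \<Omega> i (s + i)"
    then have "A *\<^sub>v u \<in> joint_krylov_vectors A y \<Omega> (Suc i) (s + Suc i)"
    proof (unfold joint_krylov_vectors_def, elim UnE)
      assume "u \<in> {A ^\<^sub>m l *\<^sub>v y | l. l < i}"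
      then obtain l where l: "u = A ^\<^sub>m l *\<^sub>v y" "l < i" by blast
      then have "A *\<^sub>v u = A ^\<^sub>m Suc l *\<^sub>v y" using pow_mat_Suc_mult_vec[OF A y] by simp
      then show "A *\<^sub>v u \<in> {A ^\<^sub>m l *\<^sub>v y | l. l < Suc i} \<union>
          {A ^\<^sub>m l *\<^sub>v w | l w. l < s + Suc i \<and> w \<in> set (cols \<Omega>)}" using l by blast
    next
      assume "u \<in> {A ^\<^sub>m l *\<^sub>v w | l w. l < s + i \<and> w \<in> set (cols \<Omega>)}"
      then obtain l w where l: "u = A ^\<^sub>m l *\<^sub>v w" "l < s + i" "w \<in> set (cols \<Omega>)" by blast
      then have "w \<in> carrier_vec m" using cols_dim[of \<Omega>] \<Omega> by auto
      then have "A *\<^sub>v u = A ^\<^sub>m Suc l *\<^sub>v w" using l pow_mat_Suc_mult_vec[OF A] by simp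
      moreover have "Suc l < s + Suc i" using l by simp
      ultimately show "A *\<^sub>v u \<in> {A ^\<^sub>m l *\<^sub>v y | l. l < Suc i} \<union>
          {A ^\<^sub>m l *\<^sub>v w | l w. l < s + Suc i \<and> w \<in> set (cols \<Omega>)}" using l by blast
    qed
    then show "A *\<^sub>v u \<in> vec_span m (joint_krylov_vectors A y \<Omega> (Suc i) (s + Suc i))"
      using vec_span_superset[OF carrier] by blast
  qed
  then show "(1\<^sub>m m + X) *\<^sub>v (A *\<^sub>v v) \<in> L (Suc i) (s + Suc i)"
    using preconditioner A vc by simp
qed

text \<open>In eigencoordinates, \<open>G (d q(d) c)\<close> is \<open>N q(N) x\<close> for \<open>N = (I + X) A\<close> and \<open>x = G c\<close>. Horner's scheme
  proves the inclusion: as \<open>N x = (I + X) y\<close>, passing from \<open>q\<close> to \<open>a + t q\<close> replaces the vector \<open>v\<close>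
  by \<open>a (I + X) y + N v\<close>, one step of \<open>joint_krylov_step\<close>.\<close>

lemma polynomial_iterate_in_joint_krylov:
  assumes A: "A \<in> carrier_mat m m" and y: "y \<in> carrier_vec m" and \<Omega>: "\<Omega> \<in> carrier_mat m n"
    and X: "X \<in> carrier_mat m m" "mat_range X \<subseteq> krylov A \<Omega> (s + 1)"
    and G: "G \<in> carrier_mat m m" and diag: "(1\<^sub>m m + X) * A * G = G * mat_diag m d"
    and c: "c \<in> carrier_vec m" "A *\<^sub>v (G *\<^sub>v c) = y"
    and q: "q = 0 \<or> degree q < j"
  shows "G *\<^sub>v vec m (\<lambda>i. d i * poly q (d i) * c $ i) \<in> vec_span m (joint_krylov_vectors A y \<Omega> j (s + j))"
  using q
proof (induction q arbitrary: j rule: pCons_induct)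
  case 0
  have "vec m (\<lambda>i. d i * poly 0 (d i) * c $ i) = 0\<^sub>v m" by auto
  moreover have "G *\<^sub>v 0\<^sub>v m = 0\<^sub>v m" using G by auto
  ultimately show ?case by (simp only: vec_span_zero)
next
  case (pCons a q)
  note step = joint_krylov_step[OF A y \<Omega> X]
  let ?L = "\<lambda>i. vec_span m (joint_krylov_vectors A y \<Omega> i (s + i))"
  have "pCons a q \<noteq> 0" using pCons by auto
  then obtain j' where j: "j = Suc j'" and q: "q = 0 \<or> degree q < j'"
    using pCons.prems by (cases j) (auto split: if_splits)
  have Q: "1\<^sub>m m + X \<in> carrier_mat m m" using X by simp
  have QA: "(1\<^sub>m m + X) * A \<in> carrier_mat m m" using Q A by (rule mult_carrier_mat)
  have GD: "G *\<^sub>v vec m (\<lambda>i. d i * w $ i) = (1\<^sub>m m + X) *\<^sub>v (A *\<^sub>v (G *\<^sub>v w))"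
    if w: "w \<in> carrier_vec m" for w
  proof -
    have Gw: "G *\<^sub>v w \<in> carrier_vec m" using G w by simp
    have "G *\<^sub>v vec m (\<lambda>i. d i * w $ i) = (G * mat_diag m d) *\<^sub>v w"
      unfolding mat_diag_mult_vec[OF w, symmetric] assoc_mult_mat_vec[OF G mat_diag_dim w] ..
    also have "\<dots> = (1\<^sub>m m + X) *\<^sub>v (A *\<^sub>v (G *\<^sub>v w))"
      unfolding diag[symmetric] assoc_mult_mat_vec[OF QA G w] assoc_mult_mat_vec[OF Q A Gw] ..
    finally show ?thesis .
  qed
  let ?w = "vec m (\<lambda>i. d i * poly q (d i) * c $ i)"
  have split: "vec m (\<lambda>i. d i * poly (pCons a q) (d i) * c $ i)
      = a \<cdot>\<^sub>v vec m (\<lambda>i. d i * c $ i) + vec m (\<lambda>i. d i * ?w $ i)"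
    by (rule eq_vecI) (auto simp: algebra_simps)
  have vc: "vec m (\<lambda>i. d i * c $ i) \<in> carrier_vec m" "vec m (\<lambda>i. d i * ?w $ i) \<in> carrier_vec m" by auto
  have "G *\<^sub>v vec m (\<lambda>i. d i * poly (pCons a q) (d i) * c $ i)
      = a \<cdot>\<^sub>v ((1\<^sub>m m + X) *\<^sub>v y) + (1\<^sub>m m + X) *\<^sub>v (A *\<^sub>v (G *\<^sub>v ?w))"
    unfolding split mult_add_distrib_mat_vec[OF G smult_carrier_vec[THEN iffD2, OF vc(1)] vc(2)]
      mult_mat_vec[OF G vc(1)] GD[OF c(1)] c(2) using GD[of ?w] by simp
  moreover have "(1\<^sub>m m + X) *\<^sub>v y \<in> ?L j"
  proof -
    have "vec_span m (joint_krylov_vectors A y \<Omega> 1 (s + 1)) \<subseteq> ?L j"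
      by (intro vec_span_mono) (force simp: joint_krylov_vectors_def j)
    with step(1) show ?thesis by blast
  qed
  moreover have "(1\<^sub>m m + X) *\<^sub>v (A *\<^sub>v (G *\<^sub>v ?w)) \<in> ?L j"
    unfolding j by (rule step(2)[OF pCons.IH[OF q]])
  ultimately show ?case
    using vec_span_add[OF joint_krylov_vectors_carrier[OF A y \<Omega>]]
      vec_span_smult[OF joint_krylov_vectors_carrier[OF A y \<Omega>]] by simp
qed

text \<open>Block \<open>j\<close> of the method writes \<open>A\<^sup>j Z\<close> as \<open>V (V\<^sup>T A\<^sup>j Z) + Q R\<close>, and the columns of \<open>V\<close> and \<open>Q\<close> are columns of \<open>W\<close>.\<close>

lemma block_lanczos_range:
  assumes A: "A \<in> carrier_mat m m" and Z: "Z \<in> carrier_mat m b" and W: "block_lanczos A Z k W"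
  shows "krylov A Z k \<subseteq> mat_range W"
proof -
  have Wc: "W \<in> carrier_mat m (k * b)" using W Z by (simp add: block_lanczos_def Let_def)
  have WcolsC: "set (cols W) \<subseteq> carrier_vec m" using cols_dim[of W] Wc by auto
  have sub: "mat_range (mat_of_cols m us) \<subseteq> mat_range W" if "set us \<subseteq> set (cols W)" for us
    unfolding mat_range_eq_vec_span[OF Wc] mat_range_eq_vec_span[OF mat_of_cols_carrier(1)]
    using that WcolsC by (intro vec_span_mono) (simp add: cols_mat_of_cols)
  have "A ^\<^sub>m l *\<^sub>v w \<in> mat_range W" if l: "l < k" and w: "w \<in> set (cols Z)" for l w
  proof -
    define V where "V = leading_blocks b W l"
    define Q where "Q = block_of b W l"
    define B where "B = A ^\<^sub>m l * Z"
    have B: "B \<in> carrier_mat m b" unfolding B_def by (rule mult_carrier_mat[OF pow_carrier_mat[OF A] Z])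
    obtain R where R: "R \<in> carrier_mat b b" and BVQ: "B - V * (V\<^sup>T * B) = Q * R"
      using W Z l by (auto simp: block_lanczos_def Let_def V_def Q_def B_def)
    have V: "V \<in> carrier_mat m (dim_col V)" and Q: "Q \<in> carrier_mat m (dim_col Q)"
      using Wc by (auto simp: V_def Q_def leading_blocks_def block_of_def)
    have "l * b + b \<le> k * b" using mult_le_mono1[of "Suc l" k b] l by simp
    then have "dim_col Q = b" using Wc by (simp add: Q_def block_of_def)
    with Q have Q: "Q \<in> carrier_mat m b" by simp
    obtain i where i: "i < b" "w = col Z i" using w Z by (auto simp: cols_def)
    have VB: "V\<^sup>T * B \<in> carrier_mat (dim_col V) b" using V B by (meson mult_carrier_mat transpose_carrier_mat)
    have VVB: "V * (V\<^sup>T * B) \<in> carrier_mat m b" using V VB by (rule mult_carrier_mat)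
    have e: "unit_vec b i \<in> carrier_vec b" by simp
    have "B = C + (B - C)" if "C \<in> carrier_mat m b" for C using that B by (auto intro!: eq_matI)
    from this[OF VVB] have "B = V * (V\<^sup>T * B) + Q * R" unfolding BVQ .
    then have "B *\<^sub>v unit_vec b i = V *\<^sub>v ((V\<^sup>T * B) *\<^sub>v unit_vec b i) + Q *\<^sub>v (R *\<^sub>v unit_vec b i)"
      using add_mult_distrib_mat_vec[OF VVB mult_carrier_mat[OF Q R] e]
        assoc_mult_mat_vec[OF V VB e] assoc_mult_mat_vec[OF Q R e] by simp
    moreover have "B *\<^sub>v unit_vec b i = A ^\<^sub>m l *\<^sub>v w"
    proof -
      have "B *\<^sub>v unit_vec b i = A ^\<^sub>m l *\<^sub>v (Z *\<^sub>v unit_vec b i)"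
        unfolding B_def by (rule assoc_mult_mat_vec[OF pow_carrier_mat[OF A] Z e])
      also have "Z *\<^sub>v unit_vec b i = w" using Z i by (auto intro!: eq_vecI)
      finally show ?thesis .
    qed
    moreover have "V *\<^sub>v ((V\<^sup>T * B) *\<^sub>v unit_vec b i) \<in> mat_range W"
    proof -
      have "V *\<^sub>v ((V\<^sup>T * B) *\<^sub>v unit_vec b i) \<in> mat_range V"
        unfolding mat_range_def using mult_mat_vec_carrier[OF VB e] by blast
      moreover have "V = mat_of_cols m (take (l * b) (cols W))"
        using Wc by (simp add: V_def leading_blocks_def)
      ultimately show ?thesis using sub[OF set_take_subset] by blast
    qed
    moreover have "Q *\<^sub>v (R *\<^sub>v unit_vec b i) \<in> mat_range W"
    proof -
      have "R *\<^sub>v unit_vec b i \<in> carrier_vec (dim_col Q)"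
        using mult_mat_vec_carrier[OF R e] Q by simp
      then have "Q *\<^sub>v (R *\<^sub>v unit_vec b i) \<in> mat_range Q" unfolding mat_range_def by blast
      moreover have "Q = mat_of_cols m (take b (drop (l * b) (cols W)))"
        using Wc by (simp add: Q_def block_of_def)
      moreover have "set (take b (drop (l * b) (cols W))) \<subseteq> set (cols W)"
        using set_take_subset set_drop_subset by fast
      ultimately show ?thesis using sub by blast
    qed
    ultimately show ?thesis
      using vec_span_add[OF WcolsC] by (simp add: mat_range_eq_vec_span[OF Wc])
  qed
  then have "set (krylov_cols A Z k) \<subseteq> mat_range W" by (auto simp: set_krylov_cols[OF A Z])
  then show ?thesis
    unfolding krylov_def mat_range_eq_vec_span[OF Wc] using A
    by (simp add: vec_span_subset[OF _ WcolsC])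
qed

section \<open>The error bound\<close>

theorem theorem3:
  fixes A \<Omega> W T X P :: "real mat" and y :: "real vec" and m n\<^sub>\<Omega> k s :: nat and \<kappa> :: real
  assumes A: "spd m A"
    and y: "y \<in> carrier_vec m" "y \<noteq> 0\<^sub>v m"
    and \<Omega>: "\<Omega> \<in> carrier_mat m n\<^sub>\<Omega>"
    and k: "1 \<le> k"
    and constant_block_size: "lin_indpt_list m (krylov_cols A (augment y \<Omega>) k)"
    and W: "block_lanczos A (augment y \<Omega>) k W"
    and W_first_col: "col W 0 = (1 / eucl_norm y) \<cdot>\<^sub>v y"
    and T: "T = W\<^sup>T * A * W"
    and s: "s \<le> k"
    and X: "X \<in> carrier_mat m m" "mat_range X \<subseteq> krylov A \<Omega> (s + 1)"
    and P: "invertible_mat (1\<^sub>m m + X)" "P = mat_inv (1\<^sub>m m + X)" "spd m P"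
    and \<kappa>: "\<kappa> = condition_number (mat_inv_sqrt P * A * mat_inv_sqrt P)"
  shows "0 \<le> (y \<bullet> (mat_inv A *\<^sub>v y) - (eucl_norm y)\<^sup>2 * mat_inv T $$ (0, 0))
               / (y \<bullet> (mat_inv A *\<^sub>v y)) \<and>
         (y \<bullet> (mat_inv A *\<^sub>v y) - (eucl_norm y)\<^sup>2 * mat_inv T $$ (0, 0))
               / (y \<bullet> (mat_inv A *\<^sub>v y))
           \<le> 4 * ((sqrt \<kappa> - 1) / (sqrt \<kappa> + 1)) ^ (2 * (k - s))"
proof -
  note Ac = spd_carrier[OF A]
  define Z where "Z = augment y \<Omega>"
  define Q where "Q = 1\<^sub>m m + X"
  define x where "x = mat_inv A *\<^sub>v y"
  have colsZ: "set (y # cols \<Omega>) \<subseteq> carrier_vec m" using y(1) cols_dim[of \<Omega>] \<Omega> by auto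
  have Z: "Z \<in> carrier_mat m (Suc n\<^sub>\<Omega>)"
    using y(1) \<Omega> mat_of_cols_carrier(1)[of m "y # cols \<Omega>"] by (simp add: Z_def augment_def)
  have cols_Z: "cols Z = y # cols \<Omega>" using y(1) colsZ by (simp add: Z_def augment_def)
  define r where "r = k * Suc n\<^sub>\<Omega>"
  have Wc: "W \<in> carrier_mat m r" and WW: "W\<^sup>T * W = 1\<^sub>m r"
    using W Z by (auto simp: block_lanczos_def Let_def Z_def r_def)
  have r: "0 < r" using k by (simp add: r_def)
  have m: "0 < m" using y by (cases m) auto
  note Ainv = spd_mat_inv[OF A A]
  have x: "x \<in> carrier_vec m" unfolding x_def by (rule mult_mat_vec_carrier[OF Ainv(3) y(1)])
  have Ax: "A *\<^sub>v x = y"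
    using assoc_mult_mat_vec[OF Ac Ainv(3) y(1)] Ainv(1) y(1) by (simp add: x_def)
  have "x \<noteq> 0\<^sub>v m"
  proof
    assume "x = 0\<^sub>v m"
    then have "y = 0\<^sub>v m" using Ax Ac by (auto intro!: eq_vecI)
    with y show False by simp
  qed
  then have energy_pos: "0 < x \<bullet> (A *\<^sub>v x)" by (rule spd_pos[OF A x])
  have energy: "y \<bullet> x = x \<bullet> (A *\<^sub>v x)" unfolding Ax by (rule comm_scalar_prod[OF y(1) x])

  \<comment> \<open>The coordinates of \<open>y\<close> are \<open>\<parallel>y\<parallel> e\<^sub>0\<close>, so \<open>f \<bullet> T\<^sup>-\<^sup>1 f\<close> is \<open>\<parallel>y\<parallel>\<^sup>2\<close> times the corner entry of \<open>T\<^sup>-\<^sup>1\<close>.\<close>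
  define f where "f = W\<^sup>T *\<^sub>v (A *\<^sub>v x)"
  note galerkin = galerkin_energy_error[OF A Wc WW T x, folded f_def]
  have yy: "0 < eucl_norm y" using scalar_prod_self_pos[OF y] by (simp add: eucl_norm_def)
  have e: "unit_vec r 0 \<in> carrier_vec r" by simp
  have f: "f = eucl_norm y \<cdot>\<^sub>v unit_vec r 0"
  proof -
    have "y = eucl_norm y \<cdot>\<^sub>v col W 0" unfolding W_first_col using yy y(1) by (auto intro!: eq_vecI)
    also have "col W 0 = W *\<^sub>v unit_vec r 0" using Wc r by (auto intro!: eq_vecI)
    finally have "f = eucl_norm y \<cdot>\<^sub>v (W\<^sup>T *\<^sub>v (W *\<^sub>v unit_vec r 0))"
      unfolding f_def Ax using mult_mat_vec[of "W\<^sup>T" r m "W *\<^sub>v unit_vec r 0" "eucl_norm y"] Wc by simp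
    also have "W\<^sup>T *\<^sub>v (W *\<^sub>v unit_vec r 0) = unit_vec r 0"
      using assoc_mult_mat_vec[of "W\<^sup>T" r m W r "unit_vec r 0"] Wc WW by simp
    finally show ?thesis .
  qed
  have Tinv: "mat_inv T \<in> carrier_mat r r" using spd_mat_inv(3)[OF galerkin(3) galerkin(3)] .
  have "f \<bullet> (mat_inv T *\<^sub>v f) = (eucl_norm y)\<^sup>2 * (unit_vec r 0 \<bullet> (mat_inv T *\<^sub>v unit_vec r 0))"
    unfolding f mult_mat_vec[OF Tinv e]
    using carrier_vecD[OF mult_mat_vec_carrier[OF Tinv e]] by (simp add: power2_eq_square)
  also have "unit_vec r 0 \<bullet> (mat_inv T *\<^sub>v unit_vec r 0) = mat_inv T $$ (0, 0)"
    using scalar_prod_left_unit[OF mult_mat_vec_carrier[OF Tinv e] r] Tinv r by simp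
  finally have fTf: "f \<bullet> (mat_inv T *\<^sub>v f) = (eucl_norm y)\<^sup>2 * mat_inv T $$ (0, 0)" .
  let ?\<delta> = "x \<bullet> (A *\<^sub>v x) - (eucl_norm y)\<^sup>2 * mat_inv T $$ (0, 0)"
  note galerkin = galerkin[unfolded fTf]

  have Q: "Q \<in> carrier_mat m m" using X by (simp add: Q_def)
  \<comment> \<open>By hypothesis \<open>P\<close> is only the value of an inverse function; that \<open>Q\<close> really inverts it follows from the trivial kernel of \<open>Q\<close>.\<close>
  have QP: "Q * P = 1\<^sub>m m"
  proof -
    obtain B where B: "inverts_mat Q B" "inverts_mat B Q" using P(1) by (auto simp: invertible_mat_def Q_def)
    have dB: "dim_row B = m" "dim_col B = m"
      using B Q by (auto simp: inverts_mat_def dest!: arg_cong[of _ _ dim_col])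
    then have Bc: "B \<in> carrier_mat m m" by auto
    have BQ: "B * Q = 1\<^sub>m m" using B(2) dB by (simp add: inverts_mat_def)
    have "v = 0\<^sub>v m" if v: "v \<in> carrier_vec m" "Q *\<^sub>v v = 0\<^sub>v m" for v
    proof -
      have "v = B *\<^sub>v (Q *\<^sub>v v)" using assoc_mult_mat_vec[OF Bc Q v(1)] BQ v(1) by simp
      then show ?thesis using v Bc by (auto intro!: eq_vecI)
    qed
    from mat_inv_if_trivial_kernel(1)[OF Q this] show ?thesis by (simp add: P(2) Q_def)
  qed
  define M where "M = mat_inv_sqrt P * A * mat_inv_sqrt P"
  obtain G d where G: "G \<in> carrier_mat m m" "\<forall>x \<in> carrier_vec m. \<exists>c \<in> carrier_vec m. x = G *\<^sub>v c"
      "Q * A * G = G * mat_diag m d" "G\<^sup>T * A * G = mat_diag m d" and d: "\<forall>i<m. d i \<in> spectrum M"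
    using preconditioned_eigenbasis(1)[OF A P(3) Q QP] by (auto simp: M_def)
  have M: "spd m M" using preconditioned_eigenbasis(2)[OF A P(3) Q QP] by (simp add: M_def)
  obtain c where c: "c \<in> carrier_vec m" "x = G *\<^sub>v c" using G(2) x by blast
  define a where "a = Min (spectrum M)"
  define b where "b = Max (spectrum M)"
  have fin: "finite (spectrum M)" using card_finite_spectrum(1)[OF spd_carrier[OF M]] .
  have ne: "spectrum M \<noteq> {}" using d m by blast
  have a: "0 < a" using spd_spectrum_pos[OF M] Min_in[OF fin ne] by (simp add: a_def)
  have ab: "a \<le> b" using Min_le[OF fin Max_in[OF fin ne]] by (simp add: a_def b_def)
  have dab: "d i \<in> {a..b}" if "i < m" for i using d that fin by (simp add: a_def b_def)
  have \<kappa>': "\<kappa> = b / a" by (simp add: \<kappa> condition_number_def M_def a_def b_def)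
  let ?\<rho> = "2 * ((sqrt \<kappa> - 1) / (sqrt \<kappa> + 1)) ^ (k - s)"
  obtain q where q: "q = 0 \<or> degree q < k - s" "\<forall>t \<in> {a..b}. \<bar>1 - t * poly q t\<bar> \<le> ?\<rho>"
    using chebyshev_residual_polynomial[OF a ab, of "k - s"] unfolding \<kappa>' by blast

  let ?q = "vec m (\<lambda>i. d i * poly q (d i) * c $ i)"
  have AGc: "A *\<^sub>v (G *\<^sub>v c) = y" unfolding c(2)[symmetric] by (rule Ax)
  have "l < k - s \<Longrightarrow> l < k" "l < s + (k - s) \<Longrightarrow> l < k" for l using s by auto
  then have gens: "joint_krylov_vectors A y \<Omega> (k - s) (s + (k - s)) \<subseteq> set (krylov_cols A Z k)"
    unfolding joint_krylov_vectors_def set_krylov_cols[OF Ac Z] cols_Z list.set by blast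
  have "G *\<^sub>v ?q \<in> vec_span m (joint_krylov_vectors A y \<Omega> (k - s) (s + (k - s)))"
    by (rule polynomial_iterate_in_joint_krylov[OF Ac y(1) \<Omega> X G(1) G(3)[unfolded Q_def] c(1) AGc q(1)])
  also have "\<dots> \<subseteq> krylov A Z k"
    unfolding krylov_def using vec_span_mono[OF gens] Ac by simp
  also have "\<dots> \<subseteq> mat_range W" by (rule block_lanczos_range[OF Ac Z W[folded Z_def]])
  finally obtain w where w: "w \<in> carrier_vec r" "G *\<^sub>v ?q = W *\<^sub>v w" using Wc by (auto simp: mat_range_def)

  have energy_diag: "(G *\<^sub>v v) \<bullet> (A *\<^sub>v (G *\<^sub>v v)) = (\<Sum>i<m. d i * (v $ i)\<^sup>2)" if v: "v \<in> carrier_vec m" for v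
  proof -
    have Gv: "G *\<^sub>v v \<in> carrier_vec m" using G v by simp
    have GT: "G\<^sup>T \<in> carrier_mat m m" using G by simp
    have AGv: "A *\<^sub>v (G *\<^sub>v v) \<in> carrier_vec m" using Ac Gv by simp
    have "(G *\<^sub>v v) \<bullet> (A *\<^sub>v (G *\<^sub>v v)) = v \<bullet> (G\<^sup>T *\<^sub>v (A *\<^sub>v (G *\<^sub>v v)))"
      using transpose_vec_mult_scalar[OF G(1) v AGv] comm_scalar_prod[OF Gv AGv]
        comm_scalar_prod[OF v mult_mat_vec_carrier[OF GT AGv]] by simp
    also have "G\<^sup>T *\<^sub>v (A *\<^sub>v (G *\<^sub>v v)) = (G\<^sup>T * A * G) *\<^sub>v v"
      using assoc_mult_mat_vec[OF mult_carrier_mat[OF GT Ac] G(1) v] assoc_mult_mat_vec[OF GT Ac Gv] by simp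
    also have "\<dots> = mat_diag m d *\<^sub>v v" unfolding G(4) ..
    finally show ?thesis by (simp add: mat_diag_quadratic_form[OF v])
  qed
  \<comment> \<open>The energy norm of the residual is read off from its eigencoordinates \<open>p(d\<^sub>i) c\<^sub>i\<close> with \<open>p(t) = 1 - t q(t)\<close>.\<close>
  have residual: "x - W *\<^sub>v w = G *\<^sub>v (c - ?q)"
    unfolding w(2)[symmetric] c(2) by (rule mult_minus_distrib_mat_vec[OF G(1) c(1), symmetric]) simp
  have "?\<delta> \<le> (G *\<^sub>v (c - ?q)) \<bullet> (A *\<^sub>v (G *\<^sub>v (c - ?q)))"
    using galerkin(2)[OF w(1)] by (simp add: residual)
  also have "\<dots> = (\<Sum>i<m. d i * ((c - ?q) $ i)\<^sup>2)" by (rule energy_diag) (use c in simp)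
  also have "\<dots> = (\<Sum>i<m. (1 - d i * poly q (d i))\<^sup>2 * (d i * (c $ i)\<^sup>2))"
    using c(1) by (intro sum.cong) (auto simp: power2_eq_square algebra_simps)
  also have "\<dots> \<le> (\<Sum>i<m. ?\<rho>\<^sup>2 * (d i * (c $ i)\<^sup>2))"
  proof (intro sum_mono mult_right_mono)
    fix i assume "i \<in> {..<m}"
    then have i: "d i \<in> {a..b}" using dab by simp
    then have "\<bar>1 - d i * poly q (d i)\<bar> \<le> ?\<rho>" using q(2) by blast
    then show "(1 - d i * poly q (d i))\<^sup>2 \<le> ?\<rho>\<^sup>2" by (metis abs_ge_zero power2_abs power_mono)
    show "0 \<le> d i * (c $ i)\<^sup>2" using i a by simp
  qed
  also have "\<dots> = ?\<rho>\<^sup>2 * (x \<bullet> (A *\<^sub>v x))"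
    using energy_diag[OF c(1)] by (simp add: c(2) sum_distrib_left)
  also have "?\<rho>\<^sup>2 = 4 * ((sqrt \<kappa> - 1) / (sqrt \<kappa> + 1)) ^ (2 * (k - s))"
    by (simp add: power_mult_distrib power_even_eq)
  finally have upper: "?\<delta> \<le> 4 * ((sqrt \<kappa> - 1) / (sqrt \<kappa> + 1)) ^ (2 * (k - s)) * (x \<bullet> (A *\<^sub>v x))" .
  show ?thesis
    unfolding x_def[symmetric] energy
    using galerkin(1) upper energy_pos by (simp add: pos_divide_le_eq)
qed

end
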